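(* Let $\Lambda \subset \mathbb{R}^{2d}$ be a countable sequence of vectors with the property that $\Lambda = -\Lambda$. For $(m,n)\in\Lambda$, with $m,n\in\mathbb{R}^d$, let $T_{m,n}$ be the associated translation-modulation transformation, and assume that $\{g_{m,n} :(m,n) \in \Lambda\}$, $g_{m,n}=T_{m,n}(g)$, is an orthonormal basis for $L^2(\mathbb{R}^d)$ for some $g\in L^2(\mathbb{R}^d)$. Then for any $i = 1, \ldots, d$, $$\| P_i (g) \|_2 \, \| M_i (g) \|_2 = \infty .$$
   Context: The translation-modulation transformation on $L^2(\mathbb{R}^d)$ associated with $(m,n)$ is $T_{m,n}(g)(x) = e^{2\pi i n\cdot x} g(x+m)$. The Fourier transform is $\hat f(\xi) = \mathcal{F}(f)(\xi) = \int_{\mathbb{R}^d} f(x) e^{2\pi i x\cdot \xi}\,dx$, extended to a unitary operator on $L^2(\mathbb{R}^d)$. Put $P_i(f)(x) = x^i f(x)$ (multiplication by the $i$th coordinate) and $M_i(f) = \mathcal{F}^{-1}(\xi^i \hat f(\xi))$. The norm $\|P_i(f)\|_2$ (resp. $\|M_i(f)\|_2$) is understood to be $\infty$ if $x^i f(x)$ (resp. $\xi^i\hat f(\xi)$) does not belong to $L^2$. *)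

theory Defs
  imports "HOL-Analysis.Analysis"
begin

text \<open>
  Elements of \<open>L\<^sup>2\<close> are represented by Borel functions, which are to be read up to equality
  almost everywhere; every Lebesgue measurable function has a Borel representative.
\<close>

definition L2 :: "('a::euclidean_space \<Rightarrow> complex) set" where
  "L2 = {f. f \<in> borel_measurable lborel \<and> integrable lborel (\<lambda>x. (cmod (f x))\<^sup>2)}"

definition L2_inner :: "('a::euclidean_space \<Rightarrow> complex) \<Rightarrow> ('a \<Rightarrow> complex) \<Rightarrow> complex" where
  "L2_inner f g = (LINT x|lborel. f x * cnj (g x))"

text \<open>Only meaningful for functions in \<open>L2\<close>; the extended norm below is infinite elsewhere.\<close>

definition L2_norm :: "('a::euclidean_space \<Rightarrow> complex) \<Rightarrow> real" where
  "L2_norm f = sqrt (LINT x|lborel. (cmod (f x))\<^sup>2)"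

definition L2_ext_norm :: "('a::euclidean_space \<Rightarrow> complex) \<Rightarrow> ennreal" where
  "L2_ext_norm f = (if f \<in> L2 then ennreal (L2_norm f) else \<infinity>)"

definition L2_tendsto ::
  "(nat \<Rightarrow> 'a::euclidean_space \<Rightarrow> complex) \<Rightarrow> ('a \<Rightarrow> complex) \<Rightarrow> bool" where
  "L2_tendsto u f \<longleftrightarrow> (\<forall>k. u k \<in> L2) \<and> f \<in> L2 \<and>
     (\<lambda>k. L2_norm (\<lambda>x. u k x - f x)) \<longlonglongrightarrow> 0"

text \<open>
  A family (rather than a set) of functions, so that distinct indices give orthogonal functions;
  completeness is density of the finite linear combinations.
\<close>

definition L2_orthonormal_basis ::
  "'i set \<Rightarrow> ('i \<Rightarrow> 'a::euclidean_space \<Rightarrow> complex) \<Rightarrow> bool" where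
  "L2_orthonormal_basis I e \<longleftrightarrow>
     (\<forall>i\<in>I. e i \<in> L2) \<and>
     (\<forall>i\<in>I. \<forall>j\<in>I. L2_inner (e i) (e j) = (if i = j then 1 else 0)) \<and>
     (\<forall>f\<in>L2. \<forall>\<epsilon>>0. \<exists>J c. finite J \<and> J \<subseteq> I \<and>
        L2_norm (\<lambda>x. f x - (\<Sum>i\<in>J. c i * e i x)) < \<epsilon>)"

definition fourier_integral ::
  "('a::euclidean_space \<Rightarrow> complex) \<Rightarrow> 'a \<Rightarrow> complex" where
  "fourier_integral f \<xi> = (LINT x|lborel. f x * exp (2 * pi * \<i> * complex_of_real (x \<bullet> \<xi>)))"

text \<open>
  The unitary extension to \<open>L\<^sup>2\<close>: \<open>h\<close> is the transform of \<open>f\<close> if it is the \<open>L\<^sup>2\<close>-limit of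
  the Fourier integrals of functions in \<open>L\<^sup>1 \<inter> L\<^sup>2\<close> that converge to \<open>f\<close> in \<open>L\<^sup>2\<close>. By
  Plancherel's theorem such an \<open>h\<close> exists for every \<open>f\<close> in \<open>L\<^sup>2\<close>, and is unique almost
  everywhere; the choice below selects a representative.
\<close>

definition is_fourier_L2 ::
  "('a::euclidean_space \<Rightarrow> complex) \<Rightarrow> ('a \<Rightarrow> complex) \<Rightarrow> bool" where
  "is_fourier_L2 f h \<longleftrightarrow>
     (\<exists>u. (\<forall>k. integrable lborel (u k)) \<and> L2_tendsto u f \<and>
          L2_tendsto (\<lambda>k. fourier_integral (u k)) h)"

definition fourier_L2 :: "('a::euclidean_space \<Rightarrow> complex) \<Rightarrow> 'a \<Rightarrow> complex" where
  "fourier_L2 f = (SOME h. is_fourier_L2 f h)"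

definition inv_fourier_L2 :: "('a::euclidean_space \<Rightarrow> complex) \<Rightarrow> 'a \<Rightarrow> complex" where
  "inv_fourier_L2 h = (SOME f. f \<in> L2 \<and> (AE \<xi> in lborel. fourier_L2 f \<xi> = h \<xi>))"

definition trans_mod ::
  "real ^ 'd \<Rightarrow> real ^ 'd \<Rightarrow> (real ^ 'd \<Rightarrow> complex) \<Rightarrow> real ^ 'd \<Rightarrow> complex" where
  "trans_mod m n g x = exp (2 * pi * \<i> * complex_of_real (n \<bullet> x)) * g (x + m)"

definition coord_mult :: "'d \<Rightarrow> (real ^ 'd \<Rightarrow> complex) \<Rightarrow> real ^ 'd \<Rightarrow> complex" where
  "coord_mult i f x = complex_of_real (x $ i) * f x"

definition momentum :: "'d::finite \<Rightarrow> (real ^ 'd \<Rightarrow> complex) \<Rightarrow> real ^ 'd \<Rightarrow> complex" where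
  "momentum i f = inv_fourier_L2 (coord_mult i (fourier_L2 f))"

definition position_norm :: "'d::finite \<Rightarrow> (real ^ 'd \<Rightarrow> complex) \<Rightarrow> ennreal" where
  "position_norm i f = L2_ext_norm (coord_mult i f)"

text \<open>
  The case distinction is needed because \<open>inv_fourier_L2\<close>, and hence \<open>momentum i f\<close>, is
  unspecified when its argument is not in \<open>L2\<close>.
\<close>

definition momentum_norm :: "'d::finite \<Rightarrow> (real ^ 'd \<Rightarrow> complex) \<Rightarrow> ennreal" where
  "momentum_norm i f =
     (if coord_mult i (fourier_L2 f) \<in> L2 then L2_ext_norm (momentum i f) else \<infinity>)"

end

theory Submission
  imports Defs "HOL-Probability.Characteristic_Functions"
begin

text \<open>
  Suppose that both \<open>p = P g\<close> and \<open>q = M g\<close> lie in \<open>L2\<close>, and write \<open>P\<^sub>\<mu>\<close>, \<open>Q\<^sub>\<mu>\<close> for position and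
  momentum applied to \<open>g\<^sub>\<mu>\<close>. The canonical commutation relation makes \<open>Im \<langle>Q\<^sub>\<mu>, P\<^sub>\<mu>\<rangle>\<close> a nonzero
  constant, independent of \<open>\<mu>\<close>. Expanding \<open>\<langle>Q\<^sub>\<mu>, P\<^sub>\<mu>\<rangle>\<close> in the orthonormal basis gives the sum over
  \<open>\<nu>\<close> of \<open>\<langle>Q\<^sub>\<mu>, g\<^sub>\<nu>\<rangle> \<langle>g\<^sub>\<nu>, P\<^sub>\<mu>\<rangle>\<close>, and orthogonality together with \<open>\<Lambda> = - \<Lambda>\<close> shows that replacing
  \<open>(\<mu>, \<nu>)\<close> by \<open>(- \<mu>, - \<nu>)\<close> conjugates each term. So the imaginary part at \<open>- \<mu>\<close> is the negative
  of the one at \<open>\<mu>\<close>, a contradiction. Comparing \<open>\<mu>\<close> with \<open>- \<mu>\<close>, rather than working at the origin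
  as for lattices, avoids assuming \<open>0 \<in> \<Lambda>\<close>.
\<close>

section \<open>The space L2 of square integrable functions\<close>

text \<open>Only \<open>p\<close> and \<open>q\<close> are known to lie in \<open>L2\<close>;
  \<open>g\<close> has no further regularity, so position applied to \<open>q\<close> or momentum
  applied to \<open>p\<close> need not lie in \<open>L2\<close> and the commutator cannot be formed
  as an operator. What remains is the form \<open>L2_inner q p\<close>. Its imaginary part is read
  off from the phase by which translations and modulations fail to commute; with the kernel exp(2 pi
  i x.xi) it is -1/(4 pi) for a function of norm 1. The terms of the expansion behave well because
  applying position or momentum to a shifted copy of \<open>g\<close> equals shifting
  \<open>p\<close> or \<open>q\<close>, up to a real multiple of that copy of \<open>g\<close>. This
  correction is orthogonal to every other basis element, so off the diagonal it disappears, while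
  the diagonal terms are real by self-adjointness. Everything that is used of the Fourier transform
  (existence, uniqueness, unitarity, surjectivity) is derived by density from finite combinations of
  shifted Gaussians, where the inversion formula is an explicit computation.\<close>

lemma L2_measurable: "f \<in> L2 \<Longrightarrow> f \<in> borel_measurable borel"
  by (simp add: L2_def)

lemma L2_square_integrable: "f \<in> L2 \<Longrightarrow> integrable lborel (\<lambda>x. (cmod (f x))\<^sup>2)"
  by (simp add: L2_def)

lemma borel_measurable_cnj [measurable (raw)]:
  "f \<in> borel_measurable M \<Longrightarrow> (\<lambda>x. cnj (f x)) \<in> borel_measurable M"
  by (rule borel_measurable_continuous_on[OF continuous_on_cnj[OF continuous_on_id]])

lemma L2_dominated:
  assumes "g \<in> L2" "f \<in> borel_measurable borel" "\<And>x. cmod (f x) \<le> C * cmod (g x)"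
  shows "f \<in> L2"
proof -
  have "integrable lborel (\<lambda>x. (cmod (f x))\<^sup>2)"
  proof (rule Bochner_Integration.integrable_bound)
    show "integrable lborel (\<lambda>x. C\<^sup>2 * (cmod (g x))\<^sup>2)"
      using L2_square_integrable[OF assms(1)] by simp
    show "(\<lambda>x. (cmod (f x))\<^sup>2) \<in> borel_measurable lborel"
      using assms(2) by measurable
    have "(cmod (f x))\<^sup>2 \<le> C\<^sup>2 * (cmod (g x))\<^sup>2" for x
      using power_mono[OF assms(3)[of x], of 2] by (simp add: power_mult_distrib)
    then show "AE x in lborel. norm ((cmod (f x))\<^sup>2) \<le> norm (C\<^sup>2 * (cmod (g x))\<^sup>2)"
      by simp
  qed
  with assms(2) show ?thesis by (simp add: L2_def)
qed

lemma L2_scale [intro]: "f \<in> L2 \<Longrightarrow> (\<lambda>x. c * f x) \<in> L2"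
  by (rule L2_dominated[where C = "cmod c" and g = f])
    (auto simp: norm_mult intro: borel_measurable_times L2_measurable)

lemma L2_cnj [intro]: "f \<in> L2 \<Longrightarrow> (\<lambda>x. cnj (f x)) \<in> L2"
  by (rule L2_dominated[where C = 1 and g = f]) (auto intro: borel_measurable_cnj L2_measurable)

lemma L2_zero [intro, simp]: "(\<lambda>x. 0) \<in> L2"
  by (simp add: L2_def)

lemma L2_add [intro]:
  assumes "f \<in> L2" "g \<in> L2"
  shows "(\<lambda>x. f x + g x) \<in> L2"
proof -
  have [measurable]: "f \<in> borel_measurable borel" "g \<in> borel_measurable borel"
    using assms by (auto dest: L2_measurable)
  have "integrable lborel (\<lambda>x. (cmod (f x + g x))\<^sup>2)"
  proof (rule Bochner_Integration.integrable_bound)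
    show "integrable lborel (\<lambda>x. 2 * (cmod (f x))\<^sup>2 + 2 * (cmod (g x))\<^sup>2)"
      using assms by (intro Bochner_Integration.integrable_add integrable_mult_right L2_square_integrable)
    have "(cmod (f x + g x))\<^sup>2 \<le> 2 * (cmod (f x))\<^sup>2 + 2 * (cmod (g x))\<^sup>2" for x
    proof -
      have "(cmod (f x + g x))\<^sup>2 \<le> (cmod (f x) + cmod (g x))\<^sup>2"
        by (intro power_mono norm_triangle_ineq) auto
      also have "\<dots> \<le> 2 * (cmod (f x))\<^sup>2 + 2 * (cmod (g x))\<^sup>2"
        using zero_le_power2[of "cmod (f x) - cmod (g x)"] by (simp add: power2_eq_square algebra_simps)
      finally show ?thesis .
    qed
    then show "AE x in lborel. norm ((cmod (f x + g x))\<^sup>2) \<le> norm (2 * (cmod (f x))\<^sup>2 + 2 * (cmod (g x))\<^sup>2)"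
      by simp
  qed measurable
  then show ?thesis by (simp add: L2_def)
qed

lemma L2_uminus [intro]: "f \<in> L2 \<Longrightarrow> (\<lambda>x. - f x) \<in> L2"
  using L2_scale[of f "-1"] by simp

lemma L2_diff [intro]: "f \<in> L2 \<Longrightarrow> g \<in> L2 \<Longrightarrow> (\<lambda>x. f x - g x) \<in> L2"
  using L2_add[of f "\<lambda>x. - g x"] by auto

lemma L2_sum [intro]: "(\<And>j. j \<in> J \<Longrightarrow> e j \<in> L2) \<Longrightarrow> (\<lambda>x. \<Sum>j\<in>J. e j x) \<in> L2"
  by (induction J rule: infinite_finite_induct) auto

lemma L2_norm_nonneg [simp]: "0 \<le> L2_norm f"
  by (simp add: L2_norm_def)

lemma L2_norm_square: "(L2_norm f)\<^sup>2 = (LINT x|lborel. (cmod (f x))\<^sup>2)"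
  by (simp add: L2_norm_def)

lemma L2_nn_integral:
  assumes "f \<in> L2"
  shows "(\<integral>\<^sup>+x. (ennreal (cmod (f x)))\<^sup>2 \<partial>lborel) = ennreal ((L2_norm f)\<^sup>2)"
  using nn_integral_eq_integral[OF L2_square_integrable[OF assms]]
  by (simp add: L2_norm_square ennreal_power)

text \<open>Cauchy-Schwarz comes first in \<open>ennreal\<close>, because it has to yield the
  integrability of the product before a Bochner integral of that product says anything.\<close>

lemma L2_product_nn_integral:
  assumes "f \<in> L2" "g \<in> L2"
  shows "(\<integral>\<^sup>+x. ennreal (cmod (f x * g x)) \<partial>lborel) \<le> ennreal (L2_norm f * L2_norm g)"
proof -
  have [measurable]: "f \<in> borel_measurable borel" "g \<in> borel_measurable borel"
    using assms by (auto dest: L2_measurable)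
  let ?I = "\<integral>\<^sup>+x. ennreal (cmod (f x)) * ennreal (cmod (g x)) \<partial>lborel"
  have "?I\<^sup>2 \<le> (\<integral>\<^sup>+x. (ennreal (cmod (f x)))\<^sup>2 \<partial>lborel) * (\<integral>\<^sup>+x. (ennreal (cmod (g x)))\<^sup>2 \<partial>lborel)"
    by (rule Cauchy_Schwarz_nn_integral) measurable
  also have "\<dots> = ennreal ((L2_norm f * L2_norm g)\<^sup>2)"
    by (simp only: L2_nn_integral[OF assms(1)] L2_nn_integral[OF assms(2)] ennreal_mult'[symmetric]
        zero_le_power2 power_mult_distrib)
  finally have le: "?I\<^sup>2 \<le> ennreal ((L2_norm f * L2_norm g)\<^sup>2)" .
  have "?I \<le> ennreal (L2_norm f * L2_norm g)"
  proof (cases ?I)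
    case (real r)
    with le have "r\<^sup>2 \<le> (L2_norm f * L2_norm g)\<^sup>2"
      by (simp add: ennreal_power)
    then have "r \<le> L2_norm f * L2_norm g"
      by (rule power2_le_imp_le) simp
    with real show ?thesis by (simp add: ennreal_leI)
  next
    case top
    with le show ?thesis by (simp add: top_unique)
  qed
  then show ?thesis
    by (simp add: norm_mult ennreal_mult)
qed

lemma L2_product_integrable:
  assumes "f \<in> L2" "g \<in> L2"
  shows "integrable lborel (\<lambda>x. f x * g x)"
proof (rule integrableI_bounded)
  show "(\<lambda>x. f x * g x) \<in> borel_measurable lborel"
    using assms[THEN L2_measurable] by simp
  show "(\<integral>\<^sup>+x. ennreal (norm (f x * g x)) \<partial>lborel) < \<infinity>"
    using L2_product_nn_integral[OF assms] by (rule le_less_trans) simp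
qed

lemma L2_inner_integrable:
  "f \<in> L2 \<Longrightarrow> g \<in> L2 \<Longrightarrow> integrable lborel (\<lambda>x. f x * cnj (g x))"
  by (intro L2_product_integrable L2_cnj)

lemma L2_norm_cnj [simp]: "L2_norm (\<lambda>x. cnj (f x)) = L2_norm f"
  by (simp add: L2_norm_def)

lemma L2_Cauchy_Schwarz:
  assumes "f \<in> L2" "g \<in> L2"
  shows "cmod (L2_inner f g) \<le> L2_norm f * L2_norm g"
proof -
  have "ennreal (cmod (L2_inner f g)) \<le> (\<integral>\<^sup>+x. ennreal (cmod (f x * cnj (g x))) \<partial>lborel)"
    unfolding L2_inner_def by (rule integral_norm_bound_ennreal[OF L2_inner_integrable[OF assms]])
  also have "\<dots> \<le> ennreal (L2_norm f * L2_norm (\<lambda>x. cnj (g x)))"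
    by (rule L2_product_nn_integral) (use assms in auto)
  finally show ?thesis by simp
qed

lemma L2_inner_self: "L2_inner f f = complex_of_real ((L2_norm f)\<^sup>2)"
proof -
  have "L2_inner f f = (LINT x|lborel. complex_of_real ((cmod (f x))\<^sup>2))"
    unfolding L2_inner_def by (simp add: complex_norm_square del: of_real_power)
  then show ?thesis by (simp only: integral_complex_of_real L2_norm_square)
qed

lemma L2_inner_cnj: "cnj (L2_inner f g) = L2_inner g f"
  by (simp add: L2_inner_def Bochner_Integration.integral_cnj[symmetric] mult.commute del: Bochner_Integration.integral_cnj)

lemma L2_inner_diff_left:
  "f \<in> L2 \<Longrightarrow> g \<in> L2 \<Longrightarrow> h \<in> L2 \<Longrightarrow> L2_inner (\<lambda>x. f x - g x) h = L2_inner f h - L2_inner g h"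
  by (simp add: L2_inner_def left_diff_distrib Bochner_Integration.integral_diff L2_inner_integrable)

lemma L2_inner_scale_left: "L2_inner (\<lambda>x. c * f x) h = c * L2_inner f h"
  by (simp add: L2_inner_def mult.assoc)

lemma L2_inner_diff_right:
  "f \<in> L2 \<Longrightarrow> g \<in> L2 \<Longrightarrow> h \<in> L2 \<Longrightarrow> L2_inner h (\<lambda>x. f x - g x) = L2_inner h f - L2_inner h g"
  by (simp add: L2_inner_def right_diff_distrib Bochner_Integration.integral_diff L2_inner_integrable)

lemma L2_inner_scale_right: "L2_inner h (\<lambda>x. c * f x) = cnj c * L2_inner h f"
  by (simp add: L2_inner_def mult.left_commute)

lemma L2_inner_sum_left:
  assumes "\<And>j. j \<in> J \<Longrightarrow> e j \<in> L2" "h \<in> L2"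
  shows "L2_inner (\<lambda>x. \<Sum>j\<in>J. e j x) h = (\<Sum>j\<in>J. L2_inner (e j) h)"
proof -
  have "L2_inner (\<lambda>x. \<Sum>j\<in>J. e j x) h = (LINT x|lborel. (\<Sum>j\<in>J. e j x * cnj (h x)))"
    by (simp add: L2_inner_def sum_distrib_right)
  also have "\<dots> = (\<Sum>j\<in>J. L2_inner (e j) h)"
    unfolding L2_inner_def by (rule Bochner_Integration.integral_sum) (simp add: assms L2_inner_integrable)
  finally show ?thesis .
qed

lemma L2_norm_scale: "L2_norm (\<lambda>x. c * f x) = cmod c * L2_norm f"
  by (simp add: L2_norm_def norm_mult power_mult_distrib real_sqrt_mult)

lemma L2_norm_diff_square:
  assumes "f \<in> L2" "g \<in> L2"
  shows "(L2_norm (\<lambda>x. f x - g x))\<^sup>2 = (L2_norm f)\<^sup>2 - 2 * Re (L2_inner f g) + (L2_norm g)\<^sup>2"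
proof -
  have "complex_of_real ((L2_norm (\<lambda>x. f x - g x))\<^sup>2) = L2_inner (\<lambda>x. f x - g x) (\<lambda>x. f x - g x)"
    by (simp only: L2_inner_self)
  also have "\<dots> = L2_inner f f - L2_inner f g - cnj (L2_inner f g) + L2_inner g g"
    using assms by (simp add: L2_inner_diff_left L2_inner_diff_right L2_diff L2_inner_cnj)
  finally have "Re (complex_of_real ((L2_norm (\<lambda>x. f x - g x))\<^sup>2)) =
      Re (L2_inner f f - L2_inner f g - cnj (L2_inner f g) + L2_inner g g)"
    by (rule arg_cong)
  then show ?thesis by (simp add: L2_inner_self)
qed

lemma L2_norm_uminus [simp]: "L2_norm (\<lambda>x. - f x) = L2_norm f"
  by (simp add: L2_norm_def)

lemma L2_norm_triangle:
  assumes "f \<in> L2" "g \<in> L2"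
  shows "L2_norm (\<lambda>x. f x - g x) \<le> L2_norm f + L2_norm g"
proof (rule power2_le_imp_le)
  have "- Re (L2_inner f g) \<le> L2_norm f * L2_norm g"
    using L2_Cauchy_Schwarz[OF assms] abs_Re_le_cmod[of "L2_inner f g"] by linarith
  then show "(L2_norm (\<lambda>x. f x - g x))\<^sup>2 \<le> (L2_norm f + L2_norm g)\<^sup>2"
    using assms by (simp add: L2_norm_diff_square power2_sum)
qed simp

lemma L2_norm_minus_commute: "L2_norm (\<lambda>x. f x - g x) = L2_norm (\<lambda>x. g x - f x)"
  by (simp add: L2_norm_def norm_minus_commute)

lemma L2_norm_triangle_add:
  "f \<in> L2 \<Longrightarrow> g \<in> L2 \<Longrightarrow> L2_norm (\<lambda>x. f x + g x) \<le> L2_norm f + L2_norm g"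
  using L2_norm_triangle[of f "\<lambda>x. - g x"] by auto

lemma L2_dist_triangle:
  assumes "f \<in> L2" "g \<in> L2" "h \<in> L2"
  shows "L2_norm (\<lambda>x. f x - h x) \<le> L2_norm (\<lambda>x. f x - g x) + L2_norm (\<lambda>x. g x - h x)"
  using L2_norm_triangle_add[of "\<lambda>x. f x - g x" "\<lambda>x. g x - h x"] assms by auto

lemma L2_norm_AE_cong:
  assumes "AE x in lborel. f x = g x" "f \<in> borel_measurable borel" "g \<in> borel_measurable borel"
  shows "L2_norm f = L2_norm g"
proof -
  have "(LINT x|lborel. (cmod (f x))\<^sup>2) = (LINT x|lborel. (cmod (g x))\<^sup>2)"
    using assms by (intro integral_cong_AE) auto
  then show ?thesis by (simp add: L2_norm_def)
qed

lemma L2_inner_AE_cong: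
  assumes "AE x in lborel. f x = g x" "f \<in> L2" "g \<in> L2" "h \<in> L2"
  shows "L2_inner f h = L2_inner g h"
  unfolding L2_inner_def
  using assms by (intro integral_cong_AE) (auto dest!: L2_measurable)

lemma L2_norm_eq_0_iff:
  assumes "f \<in> L2"
  shows "L2_norm f = 0 \<longleftrightarrow> (AE x in lborel. f x = 0)"
  using integral_nonneg_eq_0_iff_AE[OF L2_square_integrable[OF assms]]
  by (simp add: L2_norm_def)

lemma L2_tendsto_inner:
  assumes u: "L2_tendsto u f" and v: "L2_tendsto v h"
  shows "(\<lambda>k. L2_inner (u k) (v k)) \<longlonglongrightarrow> L2_inner f h"
proof -
  have L2: "u k \<in> L2" "v k \<in> L2" "f \<in> L2" "h \<in> L2" for k
    using u v by (auto simp: L2_tendsto_def)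
  let ?a = "\<lambda>k. L2_norm (\<lambda>x. u k x - f x)" and ?b = "\<lambda>k. L2_norm (\<lambda>x. v k x - h x)"
  have lim: "?a \<longlonglongrightarrow> 0" "?b \<longlonglongrightarrow> 0"
    using u v by (auto simp: L2_tendsto_def)
  have "cmod (L2_inner (u k) (v k) - L2_inner f h) \<le> ?a k * (L2_norm h + ?b k) + L2_norm f * ?b k" for k
  proof -
    have eq: "L2_inner (u k) (v k) - L2_inner f h =
        L2_inner (\<lambda>x. u k x - f x) (v k) + L2_inner f (\<lambda>x. v k x - h x)"
      using L2 by (simp add: L2_inner_diff_left L2_inner_diff_right L2_diff)
    have "cmod (L2_inner (\<lambda>x. u k x - f x) (v k)) \<le> ?a k * L2_norm (v k)"
      "cmod (L2_inner f (\<lambda>x. v k x - h x)) \<le> L2_norm f * ?b k"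
      using L2 by (auto intro!: L2_Cauchy_Schwarz)
    moreover have "L2_norm (v k) \<le> L2_norm h + ?b k"
      using L2_norm_triangle_add[of h "\<lambda>x. v k x - h x"] L2 by auto
    then have "?a k * L2_norm (v k) \<le> ?a k * (L2_norm h + ?b k)"
      by (intro mult_left_mono) auto
    ultimately show ?thesis
      unfolding eq
      using norm_triangle_ineq[of "L2_inner (\<lambda>x. u k x - f x) (v k)" "L2_inner f (\<lambda>x. v k x - h x)"]
      by linarith
  qed
  moreover have "(\<lambda>k. ?a k * (L2_norm h + ?b k) + L2_norm f * ?b k) \<longlonglongrightarrow> 0 * (L2_norm h + 0) + L2_norm f * 0"
    by (intro tendsto_intros lim)
  ultimately have "(\<lambda>k. L2_inner (u k) (v k) - L2_inner f h) \<longlonglongrightarrow> 0"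
    by (intro Lim_null_comparison[where f = "\<lambda>k. L2_inner (u k) (v k) - L2_inner f h"]) auto
  then show ?thesis by (simp add: LIM_zero_iff)
qed

lemma L2_tendsto_const: "f \<in> L2 \<Longrightarrow> L2_tendsto (\<lambda>k. f) f"
  by (simp add: L2_tendsto_def L2_norm_def)

lemma L2_tendsto_scale:
  assumes "L2_tendsto u f"
  shows "L2_tendsto (\<lambda>k x. c * u k x) (\<lambda>x. c * f x)"
proof -
  have "(\<lambda>k. cmod c * L2_norm (\<lambda>x. u k x - f x)) \<longlonglongrightarrow> cmod c * 0"
    using assms by (intro tendsto_intros) (auto simp: L2_tendsto_def)
  then show ?thesis
    using assms by (auto simp: L2_tendsto_def L2_norm_scale right_diff_distrib[symmetric])
qed

lemma L2_tendsto_add: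
  assumes "L2_tendsto u f" "L2_tendsto v h"
  shows "L2_tendsto (\<lambda>k x. u k x + v k x) (\<lambda>x. f x + h x)"
proof -
  have L2: "u k \<in> L2" "v k \<in> L2" "f \<in> L2" "h \<in> L2" for k
    using assms by (auto simp: L2_tendsto_def)
  have "(\<lambda>k. L2_norm (\<lambda>x. u k x - f x) + L2_norm (\<lambda>x. v k x - h x)) \<longlonglongrightarrow> 0 + 0"
    using assms by (intro tendsto_intros) (auto simp: L2_tendsto_def)
  moreover have "L2_norm (\<lambda>x. (u k x + v k x) - (f x + h x)) \<le>
      L2_norm (\<lambda>x. u k x - f x) + L2_norm (\<lambda>x. v k x - h x)" for k
    using L2_norm_triangle_add[of "\<lambda>x. u k x - f x" "\<lambda>x. v k x - h x"] L2
    by (auto simp: algebra_simps)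
  ultimately have "(\<lambda>k. L2_norm (\<lambda>x. (u k x + v k x) - (f x + h x))) \<longlonglongrightarrow> 0"
    by (intro Lim_null_comparison[where f = "\<lambda>k. L2_norm (\<lambda>x. (u k x + v k x) - (f x + h x))"]) auto
  with L2 show ?thesis by (auto simp: L2_tendsto_def)
qed

lemma L2_tendsto_AE_cong:
  assumes "L2_tendsto u f" "AE x in lborel. f x = h x" "h \<in> L2"
  shows "L2_tendsto u h"
proof -
  have "L2_norm (\<lambda>x. u k x - f x) = L2_norm (\<lambda>x. u k x - h x)" for k
    using assms by (intro L2_norm_AE_cong) (auto simp: L2_tendsto_def intro!: borel_measurable_diff L2_measurable)
  with assms show ?thesis by (simp add: L2_tendsto_def)
qed

section \<open>Completeness and orthogonal complements\<close>

text \<open>The form in which Fatou's lemma delivers its bound in \<open>L2_complete\<close>: one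
  inequality gives both membership and the estimate of the norm.\<close>

lemma L2I_nn_integral:
  assumes "f \<in> borel_measurable borel" "(\<integral>\<^sup>+x. ennreal ((cmod (f x))\<^sup>2) \<partial>lborel) \<le> ennreal (c\<^sup>2)" "0 \<le> c"
  shows "f \<in> L2" "L2_norm f \<le> c"
proof -
  have "integrable lborel (\<lambda>x. (cmod (f x))\<^sup>2)"
    using assms(1) le_less_trans[OF assms(2)] by (intro integrableI_bounded) (auto simp: less_top)
  with assms(1) show L2: "f \<in> L2" by (simp add: L2_def)
  have "ennreal ((L2_norm f)\<^sup>2) \<le> ennreal (c\<^sup>2)"
    using assms(2) L2_nn_integral[OF L2] by (simp add: ennreal_power)
  then have "(L2_norm f)\<^sup>2 \<le> c\<^sup>2" by simp
  then show "L2_norm f \<le> c" using assms(3) by (rule power2_le_imp_le)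
qed

text \<open>The weighted sum of the \<open>4 ^ k * (D k x)\<^sup>2\<close> has integral at most the
  sum of \<open>4 ^ k * (1 / 16) ^ k\<close>, hence is finite almost everywhere. There its terms are
  bounded, so the increments are at most a constant times \<open>(1 / 2) ^ k\<close> and the
  telescoping series converges absolutely.\<close>

lemma L2_rapidly_Cauchy_AE_convergent:
  assumes u: "\<And>k. u k \<in> L2"
    and close: "\<And>k. L2_norm (\<lambda>x. u (Suc k) x - u k x) \<le> (1 / 4) ^ k"
  shows "AE x in lborel. convergent (\<lambda>k. u k x)"
proof -
  have [measurable]: "u k \<in> borel_measurable borel" for k
    using u by (rule L2_measurable)
  define D where "D = (\<lambda>k x. cmod (u (Suc k) x - u k x))"
  have [measurable]: "D k \<in> borel_measurable borel" for k
    unfolding D_def by measurable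
  have D_integral: "(\<integral>\<^sup>+x. ennreal (4 ^ k * (D k x)\<^sup>2) \<partial>lborel) \<le> ennreal ((1 / 4) ^ k)" for k
  proof -
    have "(\<integral>\<^sup>+x. ennreal (4 ^ k * (D k x)\<^sup>2) \<partial>lborel)
        = ennreal (4 ^ k) * (\<integral>\<^sup>+x. (ennreal (cmod (u (Suc k) x - u k x)))\<^sup>2 \<partial>lborel)"
      unfolding D_def by (subst nn_integral_cmult[symmetric]) (auto simp: ennreal_mult ennreal_power)
    also have "\<dots> = ennreal (4 ^ k * (L2_norm (\<lambda>x. u (Suc k) x - u k x))\<^sup>2)"
      by (subst L2_nn_integral) (auto simp: ennreal_mult intro: L2_diff u)
    also have "\<dots> \<le> ennreal (4 ^ k * ((1 / 4) ^ k)\<^sup>2)"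
      by (intro ennreal_leI mult_left_mono power_mono close) auto
    also have "4 ^ k * ((1 / 4) ^ k)\<^sup>2 = ((1 / 4) ^ k :: real)"
      by (simp add: power2_eq_square power_mult_distrib[symmetric] mult.assoc[symmetric])
    finally show ?thesis .
  qed
  have "(\<integral>\<^sup>+x. (\<Sum>k. ennreal (4 ^ k * (D k x)\<^sup>2)) \<partial>lborel) = (\<Sum>k. \<integral>\<^sup>+x. ennreal (4 ^ k * (D k x)\<^sup>2) \<partial>lborel)"
    by (rule nn_integral_suminf) measurable
  also have "\<dots> \<le> (\<Sum>k. ennreal ((1 / 4) ^ k))"
    by (intro suminf_le D_integral) auto
  also have "\<dots> < \<infinity>"
    by (subst suminf_ennreal2) (auto intro: summable_geometric)
  finally have "(\<integral>\<^sup>+x. (\<Sum>k. ennreal (4 ^ k * (D k x)\<^sup>2)) \<partial>lborel) \<noteq> \<infinity>"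
    by simp
  then have "AE x in lborel. (\<Sum>k. ennreal (4 ^ k * (D k x)\<^sup>2)) \<noteq> \<infinity>"
    by (intro nn_integral_PInf_AE) measurable
  then show ?thesis
  proof eventually_elim
    case (elim x)
    have "summable (\<lambda>k. 4 ^ k * (D k x)\<^sup>2)"
      using elim by (intro summable_suminf_not_top) auto
    then have "Bseq (\<lambda>k. 4 ^ k * (D k x)\<^sup>2)"
      by (intro convergent_imp_Bseq convergentI[OF summable_LIMSEQ_zero])
    then obtain C where C: "\<And>k. 4 ^ k * (D k x)\<^sup>2 \<le> C" "C > 0"
      by (auto simp: Bseq_def)
    have bound: "D k x \<le> sqrt C * (1 / 2) ^ k" for k
    proof (rule power2_le_imp_le)
      have "4 ^ k = ((2::real) ^ k)\<^sup>2"
        by (simp add: power_mult[symmetric] mult.commute[of k] power_mult)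
      then show "(D k x)\<^sup>2 \<le> (sqrt C * (1 / 2) ^ k)\<^sup>2"
        using C(1)[of k] C(2) by (simp add: power_mult_distrib power_one_over field_simps)
    qed (use C in auto)
    have "summable (\<lambda>k. u (Suc k) x - u k x)"
    proof (rule summable_comparison_test')
      show "summable (\<lambda>k. sqrt C * (1 / 2) ^ k)"
        by (intro summable_mult summable_geometric) auto
      show "norm (u (Suc k) x - u k x) \<le> sqrt C * (1 / 2) ^ k" if "k \<ge> 0" for k
        using bound[of k] by (simp add: D_def)
    qed
    then have "convergent (\<lambda>n. \<Sum>k<n. u (Suc k) x - u k x)"
      by (simp add: summable_iff_convergent)
    then have "convergent (\<lambda>n. (u n x - u 0 x) + u 0 x)"
      by (intro convergent_add convergent_const) (simp add: sum_lessThan_telescope[of "\<lambda>k. u k x"])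
    then show "convergent (\<lambda>k. u k x)" by simp
  qed
qed

lemma L2_complete:
  assumes u: "\<And>k. u k \<in> L2"
    and Cauchy: "\<And>e. e > 0 \<Longrightarrow> \<exists>N. \<forall>m\<ge>N. \<forall>n\<ge>N. L2_norm (\<lambda>x. u m x - u n x) < e"
  obtains f where "L2_tendsto u f"
proof -
  have [measurable]: "u k \<in> borel_measurable borel" for k
    using u by (rule L2_measurable)
  have "\<exists>N. \<forall>m\<ge>N. \<forall>n\<ge>N. L2_norm (\<lambda>x. u m x - u n x) < (1 / 4) ^ k" for k
    by (rule Cauchy) simp
  then obtain N where N: "\<And>k m n. m \<ge> N k \<Longrightarrow> n \<ge> N k \<Longrightarrow> L2_norm (\<lambda>x. u m x - u n x) < (1 / 4) ^ k"
    by metis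
  \<comment> \<open>The sum dominates every \<open>N j\<close> with \<open>j \<le> k\<close>, so
    \<open>r k\<close> and \<open>r (Suc k)\<close> both pass \<open>N k\<close> although
    \<open>N\<close> need not be monotone. The summand \<open>k\<close> pushes the indices to
    infinity, which the liminf below requires.\<close>
  define r where "r k = k + (\<Sum>j\<le>k. N j)" for k
  have r_ge: "N k \<le> r k" "k \<le> r k" for k
    using member_le_sum[of k "{..k}" N] by (auto simp: r_def)
  have r_Suc: "N k \<le> r (Suc k)" for k
    using r_ge(1)[of k] by (simp add: r_def)
  \<comment> \<open>Where the subsequence diverges, \<open>lim\<close> has an unspecified value;
    this happens only on a null set, and \<open>f\<close> is measurable all the same.\<close>
  define f where "f x = lim (\<lambda>k. u (r k) x)" for x
  have [measurable]: "f \<in> borel_measurable borel"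
    unfolding f_def by measurable
  have "AE x in lborel. convergent (\<lambda>k. u (r k) x)"
    using N[OF r_Suc r_ge(1)] u by (intro L2_rapidly_Cauchy_AE_convergent) (auto intro: less_imp_le)
  then have conv: "AE x in lborel. (\<lambda>k. u (r k) x) \<longlonglongrightarrow> f x"
    by eventually_elim (simp add: f_def convergent_LIMSEQ_iff)
  \<comment> \<open>Fatou's lemma along the subsequence: the distance to the pointwise limit is
    bounded by any bound for the distances to the later terms of the whole sequence.\<close>
  have close: "(\<lambda>x. u m x - f x) \<in> L2 \<and> L2_norm (\<lambda>x. u m x - f x) \<le> e"
    if e: "e > 0" and m: "\<And>n. n \<ge> M \<Longrightarrow> L2_norm (\<lambda>x. u m x - u n x) < e" for m M e
  proof -
    let ?g = "\<lambda>k x. ennreal ((cmod (u m x - u (r k) x))\<^sup>2)"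
    have "(\<integral>\<^sup>+x. ennreal ((cmod (u m x - f x))\<^sup>2) \<partial>lborel) = (\<integral>\<^sup>+x. liminf (\<lambda>k. ?g k x) \<partial>lborel)"
    proof (rule nn_integral_cong_AE)
      show "AE x in lborel. ennreal ((cmod (u m x - f x))\<^sup>2) = liminf (\<lambda>k. ?g k x)"
        using conv
      proof eventually_elim
        case (elim x)
        then have "(\<lambda>k. ?g k x) \<longlonglongrightarrow> ennreal ((cmod (u m x - f x))\<^sup>2)"
          by (intro tendsto_intros)
        then show ?case by (intro lim_imp_Liminf[symmetric]) auto
      qed
    qed
    also have "\<dots> \<le> liminf (\<lambda>k. \<integral>\<^sup>+x. ?g k x \<partial>lborel)"
      by (rule nn_integral_liminf) measurable
    also have "\<dots> \<le> ennreal (e\<^sup>2)"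
    proof (rule Liminf_le)
      have "(\<integral>\<^sup>+x. ?g k x \<partial>lborel) \<le> ennreal (e\<^sup>2)" if "k \<ge> M" for k
      proof -
        have "(\<integral>\<^sup>+x. ?g k x \<partial>lborel) = ennreal ((L2_norm (\<lambda>x. u m x - u (r k) x))\<^sup>2)"
          using L2_nn_integral[OF L2_diff[OF u u], of m "r k"] by (simp add: ennreal_power)
        also have "\<dots> \<le> ennreal (e\<^sup>2)"
          using m[of "r k"] r_ge(2)[of k] that by (intro ennreal_leI power_mono) auto
        finally show ?thesis .
      qed
      then show "\<forall>\<^sub>F k in sequentially. (\<integral>\<^sup>+x. ?g k x \<partial>lborel) \<le> ennreal (e\<^sup>2)"
        by (auto simp: eventually_sequentially)
    qed simp
    finally show ?thesis
      using e L2I_nn_integral[of "\<lambda>x. u m x - f x" e] by auto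
  qed
  have "f \<in> L2"
  proof -
    obtain M where "\<And>m n. m \<ge> M \<Longrightarrow> n \<ge> M \<Longrightarrow> L2_norm (\<lambda>x. u m x - u n x) < 1"
      using Cauchy[of 1] by auto
    then have "(\<lambda>x. u M x - f x) \<in> L2"
      using close[of 1 M M] by auto
    from L2_diff[OF u[of M] this] show ?thesis by simp
  qed
  moreover have "(\<lambda>k. L2_norm (\<lambda>x. u k x - f x)) \<longlonglongrightarrow> 0"
  proof (rule LIMSEQ_I)
    fix e :: real assume "e > 0"
    then obtain M where "\<And>m n. m \<ge> M \<Longrightarrow> n \<ge> M \<Longrightarrow> L2_norm (\<lambda>x. u m x - u n x) < e / 2"
      using Cauchy[of "e / 2"] by auto
    then have "L2_norm (\<lambda>x. u m x - f x) \<le> e / 2" if "m \<ge> M" for m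
      using close[of "e / 2" M m] that \<open>e > 0\<close> by auto
    then show "\<exists>M. \<forall>n\<ge>M. norm (L2_norm (\<lambda>x. u n x - f x) - 0) < e"
      using \<open>e > 0\<close> by (force intro: exI[of _ M])
  qed
  ultimately have "L2_tendsto u f"
    using u by (simp add: L2_tendsto_def)
  then show ?thesis by (rule that)
qed

lemma L2_norm_add_square:
  assumes "f \<in> L2" "g \<in> L2"
  shows "(L2_norm (\<lambda>x. f x + g x))\<^sup>2 = (L2_norm f)\<^sup>2 + 2 * Re (L2_inner f g) + (L2_norm g)\<^sup>2"
  using L2_norm_diff_square[of f "\<lambda>x. (-1) * g x"] assms L2_scale[of g "-1"]
  by (simp add: L2_inner_scale_right[of f "-1" g, simplified])

lemma L2_tendsto_norm:
  assumes "L2_tendsto u f"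
  shows "(\<lambda>k. L2_norm (u k)) \<longlonglongrightarrow> L2_norm f"
proof -
  have "(\<lambda>k. sqrt (Re (L2_inner (u k) (u k)))) \<longlonglongrightarrow> sqrt (Re (L2_inner f f))"
    by (intro tendsto_intros L2_tendsto_inner assms)
  then show ?thesis by (simp add: L2_inner_self)
qed

lemma L2_tendsto_diff:
  "L2_tendsto u f \<Longrightarrow> L2_tendsto v h \<Longrightarrow> L2_tendsto (\<lambda>k x. u k x - v k x) (\<lambda>x. f x - h x)"
  using L2_tendsto_add[of u f "\<lambda>k x. (-1) * v k x" "\<lambda>x. (-1) * h x"] L2_tendsto_scale[of v h "-1"]
  by simp

text \<open>A minimizing sequence in \<open>S\<close> for the distance to \<open>f\<close> is Cauchy by the parallelogram law,
  and the difference of \<open>f\<close> and its limit is orthogonal to \<open>S\<close>.\<close>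

lemma L2_dense_of_trivial_complement:
  assumes S: "S \<subseteq> L2" "S \<noteq> {}"
    and add: "\<And>s t. s \<in> S \<Longrightarrow> t \<in> S \<Longrightarrow> (\<lambda>x. s x + t x) \<in> S"
    and scale: "\<And>c s. s \<in> S \<Longrightarrow> (\<lambda>x. c * s x) \<in> S"
    and complement: "\<And>f. f \<in> L2 \<Longrightarrow> (\<And>s. s \<in> S \<Longrightarrow> L2_inner f s = 0) \<Longrightarrow> AE x in lborel. f x = 0"
    and f: "f \<in> L2"
  obtains u where "\<And>k. u k \<in> S" "L2_tendsto u f"
proof -
  define \<delta> where "\<delta> = (INF s\<in>S. L2_norm (\<lambda>x. f x - s x))"
  have \<delta>_le: "\<delta> \<le> L2_norm (\<lambda>x. f x - s x)" if "s \<in> S" for s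
    unfolding \<delta>_def using that by (intro cINF_lower bdd_belowI[of _ 0]) auto
  have \<delta>_nonneg: "0 \<le> \<delta>"
    unfolding \<delta>_def using S by (intro cINF_greatest) auto
  have "\<exists>s\<in>S. L2_norm (\<lambda>x. f x - s x) < \<delta> + 1 / real (Suc k)" for k
    using cInf_lessD[of "(\<lambda>s. L2_norm (\<lambda>x. f x - s x)) ` S" "\<delta> + 1 / real (Suc k)"] S
    unfolding \<delta>_def by auto
  then obtain u where u: "\<And>k. u k \<in> S" "\<And>k. L2_norm (\<lambda>x. f x - u k x) < \<delta> + 1 / real (Suc k)"
    by metis
  have u_L2 [intro]: "u k \<in> L2" for k
    using u S by auto
  have parallelogram: "(L2_norm (\<lambda>x. u m x - u n x))\<^sup>2 \<le> 4 * (\<delta> + 1 / real (Suc N))\<^sup>2 - 4 * \<delta>\<^sup>2"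
    if "m \<ge> N" "n \<ge> N" for m n N
  proof -
    let ?a = "\<lambda>x. f x - u n x" and ?b = "\<lambda>x. f x - u m x"
    have L2: "?a \<in> L2" "?b \<in> L2" using f by auto
    have "(L2_norm (\<lambda>x. u m x - u n x))\<^sup>2 + (L2_norm (\<lambda>x. ?a x + ?b x))\<^sup>2 = 2 * (L2_norm ?a)\<^sup>2 + 2 * (L2_norm ?b)\<^sup>2"
      using L2_norm_diff_square[OF L2] L2_norm_add_square[OF L2] by simp
    moreover have bound: "(L2_norm (\<lambda>x. f x - u k x))\<^sup>2 \<le> (\<delta> + 1 / real (Suc N))\<^sup>2" if "k \<ge> N" for k
    proof (rule power_mono)
      have "1 / real (Suc k) \<le> 1 / real (Suc N)"
        using that by (intro divide_left_mono) auto
      then show "L2_norm (\<lambda>x. f x - u k x) \<le> \<delta> + 1 / real (Suc N)"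
        using u(2)[of k] that by auto
    qed simp
    \<comment> \<open>The midpoint of \<open>u n\<close> and \<open>u m\<close> again lies in
      \<open>S\<close>, so its distance from \<open>f\<close> is at least \<open>\<delta>\<close>;
      the sum of the two differences is twice the difference to the midpoint.\<close>
    moreover have "4 * \<delta>\<^sup>2 \<le> (L2_norm (\<lambda>x. ?a x + ?b x))\<^sup>2"
    proof -
      have "\<delta> \<le> L2_norm (\<lambda>x. f x - (1 / 2) * (u n x + u m x))"
        by (rule \<delta>_le[of "\<lambda>x. (1 / 2) * (u n x + u m x)"]) (intro scale add u)
      moreover have "L2_norm (\<lambda>x. ?a x + ?b x) = L2_norm (\<lambda>x. 2 * (f x - (1 / 2) * (u n x + u m x)))"
        by (rule arg_cong[where f = L2_norm]) (simp add: algebra_simps)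
      ultimately have "2 * \<delta> \<le> L2_norm (\<lambda>x. ?a x + ?b x)"
        by (simp only: L2_norm_scale) simp
      then have "(2 * \<delta>)\<^sup>2 \<le> (L2_norm (\<lambda>x. ?a x + ?b x))\<^sup>2"
        using \<delta>_nonneg by (intro power_mono) auto
      then show ?thesis by (simp add: power_mult_distrib)
    qed
    ultimately show ?thesis
      using bound[OF that(1)] bound[OF that(2)] by linarith
  qed
  have "\<exists>N. \<forall>m\<ge>N. \<forall>n\<ge>N. L2_norm (\<lambda>x. u m x - u n x) < e" if "e > 0" for e
  proof -
    have "(\<lambda>N. 4 * (\<delta> + 1 / real (Suc N))\<^sup>2 - 4 * \<delta>\<^sup>2) \<longlonglongrightarrow> 4 * (\<delta> + 0)\<^sup>2 - 4 * \<delta>\<^sup>2"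
      by (intro tendsto_intros LIMSEQ_Suc[OF lim_1_over_n])
    then have "eventually (\<lambda>N. 4 * (\<delta> + 1 / real (Suc N))\<^sup>2 - 4 * \<delta>\<^sup>2 < e\<^sup>2) sequentially"
      using that by (intro order_tendstoD(2)) auto
    then obtain N where "4 * (\<delta> + 1 / real (Suc N))\<^sup>2 - 4 * \<delta>\<^sup>2 < e\<^sup>2"
      by (auto simp: eventually_sequentially)
    then have "(L2_norm (\<lambda>x. u m x - u n x))\<^sup>2 < e\<^sup>2" if "m \<ge> N" "n \<ge> N" for m n
      using parallelogram[OF that] by linarith
    then show ?thesis
      using that by (intro exI[of _ N]) (auto intro: power2_less_imp_less)
  qed
  then obtain p where p: "L2_tendsto u p"
    using L2_complete[of u] u_L2 by blast
  then have p_L2: "p \<in> L2" by (simp add: L2_tendsto_def)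
  define r where "r = (\<lambda>x. f x - p x)"
  have r: "r \<in> L2" unfolding r_def using f p_L2 by auto
  have lim: "L2_tendsto (\<lambda>k x. f x - u k x) r"
    unfolding r_def by (intro L2_tendsto_diff L2_tendsto_const f p)
  have "L2_norm r \<le> \<delta> + 0"
    using u(2) by (intro LIMSEQ_le[OF L2_tendsto_norm[OF lim] tendsto_add[OF tendsto_const LIMSEQ_Suc[OF lim_1_over_n]]])
      (auto intro: less_imp_le)
  moreover have "\<delta> \<le> L2_norm (\<lambda>x. r x - c * s x)" if "s \<in> S" for s c
  proof (rule LIMSEQ_le_const)
    have "L2_tendsto (\<lambda>k x. f x - u k x - c * s x) (\<lambda>x. r x - c * s x)"
      using S that by (intro L2_tendsto_diff[OF lim] L2_tendsto_const L2_scale) auto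
    then show "(\<lambda>k. L2_norm (\<lambda>x. f x - u k x - c * s x)) \<longlonglongrightarrow> L2_norm (\<lambda>x. r x - c * s x)"
      by (rule L2_tendsto_norm)
    have "\<delta> \<le> L2_norm (\<lambda>x. f x - (u k x + c * s x))" for k
      by (rule \<delta>_le) (intro add scale u that)
    then show "\<exists>N. \<forall>k\<ge>N. \<delta> \<le> L2_norm (\<lambda>x. f x - u k x - c * s x)"
      by (simp add: diff_diff_eq)
  qed
  ultimately have nearest: "L2_norm r \<le> L2_norm (\<lambda>x. r x - c * s x)" if "s \<in> S" for s c
    using that by (metis add_0_right order_trans)
  have "L2_inner r s = 0" if s: "s \<in> S" for s
  proof -
    have s_L2: "s \<in> L2" using s S by auto
    define a where "a = L2_inner r s"
    \<comment> \<open>The best coefficient would be \<open>a\<close> divided by the squared norm of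
      \<open>s\<close>. The extra 1 covers a null \<open>s\<close> and still gives
      \<open>t * (L2_norm s)\<^sup>2 \<le> 1\<close>, which is all that the comparison
      requires.\<close>
    define t where "t = 1 / ((L2_norm s)\<^sup>2 + 1)"
    have pos: "(L2_norm s)\<^sup>2 + 1 > 0" by (smt (verit) zero_le_power2)
    have "(L2_norm r)\<^sup>2 \<le> (L2_norm (\<lambda>x. r x - (complex_of_real t * a) * s x))\<^sup>2"
      by (intro power_mono nearest s) simp
    also have "\<dots> = (L2_norm r)\<^sup>2 - 2 * (t * (cmod a)\<^sup>2) + (t * cmod a * L2_norm s)\<^sup>2"
    proof -
      have "Re (cnj (complex_of_real t * a) * a) = t * (cmod a)\<^sup>2"
        by (simp add: cmod_power2) (simp add: power2_eq_square algebra_simps)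
      moreover have "(cmod (complex_of_real t * a))\<^sup>2 = (t * cmod a)\<^sup>2"
        by (simp add: norm_mult power_mult_distrib)
      ultimately show ?thesis
        using r s_L2 by (simp only: L2_norm_diff_square[OF r L2_scale[OF s_L2]] L2_inner_scale_right
            L2_norm_scale power_mult_distrib a_def[symmetric])
    qed
    finally have "2 * (t * (cmod a)\<^sup>2) \<le> t * (cmod a)\<^sup>2 * (t * (L2_norm s)\<^sup>2)"
      by (simp add: power2_eq_square algebra_simps)
    also have "\<dots> \<le> t * (cmod a)\<^sup>2 * 1"
      using pos by (intro mult_left_mono) (auto simp: t_def field_simps)
    finally have "t * (cmod a)\<^sup>2 \<le> 0" by simp
    moreover have "t > 0" using pos by (simp add: t_def)
    ultimately have "(cmod a)\<^sup>2 \<le> 0"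
      by (simp add: mult_le_0_iff)
    then show ?thesis by (simp add: a_def)
  qed
  then have "AE x in lborel. r x = 0"
    by (rule complement[OF r])
  then have "AE x in lborel. p x = f x"
    by eventually_elim (simp add: r_def)
  then have "L2_tendsto u f"
    by (rule L2_tendsto_AE_cong[OF p _ f])
  with u(1) show ?thesis by (rule that)
qed

section \<open>Time-frequency shifts and Gaussians\<close>

lemma lborel_distr_shift: "distr lborel borel (\<lambda>x. x + m) = (lborel :: 'a::euclidean_space measure)"
proof -
  have "(\<lambda>x. x + m) = (+) m" by (auto simp: add.commute)
  then show ?thesis by (simp only: lborel_distr_plus)
qed

lemma lborel_integral_shift:
  fixes f :: "'a::euclidean_space \<Rightarrow> 'b::{banach, second_countable_topology}"
  assumes "f \<in> borel_measurable borel"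
  shows "(LINT x|lborel. f (x + m)) = (LINT x|lborel. f x)"
  using integral_distr[of "\<lambda>x. x + m" lborel borel f] assms by (simp add: lborel_distr_shift)

lemma lborel_integrable_shift_iff:
  fixes f :: "'a::euclidean_space \<Rightarrow> 'b::{banach, second_countable_topology}"
  assumes "f \<in> borel_measurable borel"
  shows "integrable lborel (\<lambda>x. f (x + m)) \<longleftrightarrow> integrable lborel f"
  using integrable_distr_eq[of "\<lambda>x. x + m" lborel borel f] assms by (simp add: lborel_distr_shift)

section \<open>Phases and time-frequency shifts\<close>

definition unit_phase :: "real \<Rightarrow> complex" where
  "unit_phase t = exp (2 * pi * \<i> * complex_of_real t)"

lemma unit_phase_add: "unit_phase (s + t) = unit_phase s * unit_phase t"
  by (simp add: unit_phase_def distrib_left exp_add)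

lemma unit_phase_0 [simp]: "unit_phase 0 = 1"
  by (simp add: unit_phase_def)

lemma unit_phase_conv_cis: "unit_phase t = cis (2 * pi * t)"
  by (simp add: unit_phase_def cis_conv_exp mult_ac)

lemma norm_unit_phase [simp]: "cmod (unit_phase t) = 1"
  by (simp add: unit_phase_conv_cis)

lemma cnj_unit_phase: "cnj (unit_phase t) = unit_phase (- t)"
  by (simp add: unit_phase_conv_cis cis_cnj)

lemma unit_phase_measurable [measurable (raw)]:
  "f \<in> borel_measurable M \<Longrightarrow> (\<lambda>x. unit_phase (f x)) \<in> borel_measurable M"
  unfolding unit_phase_conv_cis
  by (rule borel_measurable_continuous_on[of cis]) (auto intro: continuous_intros)

lemma fourier_integral_unit_phase:
  "fourier_integral f \<xi> = (LINT x|lborel. f x * unit_phase (x \<bullet> \<xi>))"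
  by (simp add: fourier_integral_def unit_phase_def)

text \<open>This is \<open>trans_mod\<close> over an arbitrary Euclidean space. Accordingly the
  coordinate \<open>x $ i\<close> is replaced below by \<open>b \<bullet> x\<close> with a unit
  vector \<open>b\<close>, so that no argument depends on the index type.\<close>

definition tf_shift :: "'a::euclidean_space \<Rightarrow> 'a \<Rightarrow> ('a \<Rightarrow> complex) \<Rightarrow> 'a \<Rightarrow> complex" where
  "tf_shift m n f x = unit_phase (n \<bullet> x) * f (x + m)"

lemma tf_shift_0 [simp]: "tf_shift 0 0 f = f"
  by (simp add: tf_shift_def fun_eq_iff)

lemma tf_shift_measurable [measurable]:
  assumes [measurable]: "f \<in> borel_measurable borel"
  shows "tf_shift m n f \<in> borel_measurable borel"
  unfolding tf_shift_def[abs_def] by measurable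

lemma norm_tf_shift: "cmod (tf_shift m n f x) = cmod (f (x + m))"
  by (simp add: tf_shift_def norm_mult)

lemma tf_shift_integrable:
  assumes "integrable lborel f"
  shows "integrable lborel (tf_shift m n f)"
proof (rule Bochner_Integration.integrable_bound)
  have [measurable]: "f \<in> borel_measurable borel"
    using borel_measurable_integrable[OF assms] by simp
  show "integrable lborel (\<lambda>x. f (x + m))"
    using assms by (simp add: lborel_integrable_shift_iff)
  show "tf_shift m n f \<in> borel_measurable lborel"
    by simp
qed (simp add: norm_tf_shift)

lemma tf_shift_L2:
  assumes "f \<in> L2"
  shows "tf_shift m n f \<in> L2"
proof -
  have [measurable]: "f \<in> borel_measurable borel"
    using assms by (rule L2_measurable)
  have "integrable lborel (\<lambda>x. (cmod (f (x + m)))\<^sup>2)"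
    using L2_square_integrable[OF assms] by (subst lborel_integrable_shift_iff[of "\<lambda>x. (cmod (f x))\<^sup>2"]) auto
  then show ?thesis by (simp add: L2_def norm_tf_shift)
qed

lemma L2_norm_tf_shift:
  assumes "f \<in> L2"
  shows "L2_norm (tf_shift m n f) = L2_norm f"
  using L2_measurable[OF assms]
  by (simp add: L2_norm_def norm_tf_shift lborel_integral_shift[of "\<lambda>x. (cmod (f x))\<^sup>2"])

lemma L2_inner_tf_shift:
  assumes "f \<in> L2" "g \<in> L2"
  shows "L2_inner (tf_shift m n f) (tf_shift m n g) = L2_inner f g"
proof -
  have [measurable]: "f \<in> borel_measurable borel" "g \<in> borel_measurable borel"
    using assms by (auto dest: L2_measurable)
  have "tf_shift m n f x * cnj (tf_shift m n g x) = f (x + m) * cnj (g (x + m))" for x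
  proof -
    have "unit_phase (n \<bullet> x) * cnj (unit_phase (n \<bullet> x)) = 1"
      by (simp add: complex_norm_square[symmetric])
    then show ?thesis
      by (simp add: tf_shift_def algebra_simps)
  qed
  then show ?thesis
    by (simp add: L2_inner_def lborel_integral_shift[of "\<lambda>x. f x * cnj (g x)"])
qed

text \<open>The phase is not symmetric in the two shifts: this cocycle is the Weyl form of the
  commutation relation, and \<open>canonical_commutation\<close> extracts its constant from
  it.\<close>

lemma tf_shift_tf_shift:
  "tf_shift m n (tf_shift m' n' f) = (\<lambda>x. unit_phase (n' \<bullet> m) * tf_shift (m + m') (n + n') f x)"
  by (rule ext) (simp add: tf_shift_def inner_add_right inner_add_left unit_phase_add add.assoc mult_ac)

lemma tf_shift_diff: "tf_shift m n (\<lambda>x. f x - g x) = (\<lambda>x. tf_shift m n f x - tf_shift m n g x)"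
  and tf_shift_scale: "tf_shift m n (\<lambda>x. c * f x) = (\<lambda>x. c * tf_shift m n f x)"
  by (rule ext, simp add: tf_shift_def algebra_simps)+

lemma L2_tendsto_tf_shift:
  assumes "L2_tendsto u f"
  shows "L2_tendsto (\<lambda>k. tf_shift m n (u k)) (tf_shift m n f)"
proof -
  have L2: "u k \<in> L2" "f \<in> L2" for k
    using assms by (auto simp: L2_tendsto_def)
  then have "L2_norm (\<lambda>x. tf_shift m n (u k) x - tf_shift m n f x) = L2_norm (\<lambda>x. u k x - f x)" for k
    using L2_norm_tf_shift[OF L2_diff[OF L2(1) L2(2)], of m n k] by (simp add: tf_shift_diff)
  with assms show ?thesis
    by (simp add: L2_tendsto_def tf_shift_L2)
qed

text \<open>Substituting y = x + m turns the translation into a modulation by \<open>- m\<close>,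
  and the modulation by \<open>n\<close> is absorbed into the frequency. The pair (m, n) is thus
  rotated to (n, -m).\<close>

lemma fourier_integral_tf_shift:
  assumes "f \<in> borel_measurable borel"
  shows "fourier_integral (tf_shift m n f) = (\<lambda>\<xi>. unit_phase (- (m \<bullet> n)) * tf_shift n (- m) (fourier_integral f) \<xi>)"
proof
  fix \<xi>
  note [measurable] = assms
  define h where "h = (\<lambda>y. f y * unit_phase ((y - m) \<bullet> (\<xi> + n)))"
  have "fourier_integral (tf_shift m n f) \<xi> = (LINT x|lborel. h (x + m))"
    unfolding fourier_integral_unit_phase
    by (intro Bochner_Integration.integral_cong)
      (auto simp: h_def tf_shift_def inner_add_right inner_commute unit_phase_add mult_ac)
  also have "\<dots> = (LINT y|lborel. h y)"
    unfolding h_def by (rule lborel_integral_shift) measurable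
  also have "\<dots> = (LINT y|lborel. unit_phase (- (m \<bullet> (\<xi> + n))) * (f y * unit_phase (y \<bullet> (\<xi> + n))))"
    unfolding h_def
    by (intro Bochner_Integration.integral_cong)
      (auto simp: inner_diff_left unit_phase_add[symmetric] mult_ac)
  also have "\<dots> = unit_phase (- (m \<bullet> (\<xi> + n))) * fourier_integral f (\<xi> + n)"
    unfolding fourier_integral_unit_phase by simp
  also have "\<dots> = unit_phase (- (m \<bullet> n)) * tf_shift n (- m) (fourier_integral f) \<xi>"
    by (simp add: tf_shift_def inner_add_right unit_phase_add[symmetric] mult.assoc[symmetric] add.commute)
  finally show "fourier_integral (tf_shift m n f) \<xi> = unit_phase (- (m \<bullet> n)) * tf_shift n (- m) (fourier_integral f) \<xi>" .
qed

section \<open>Gaussians and their Fourier transforms\<close>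

definition gauss :: "real \<Rightarrow> 'a::euclidean_space \<Rightarrow> real" where
  "gauss a x = exp (- (pi * a * (norm x)\<^sup>2))"

lemma gauss_measurable [measurable]: "gauss a \<in> borel_measurable borel"
  unfolding gauss_def[abs_def] by measurable

lemma gauss_pos [simp]: "gauss a x > 0"
  by (simp add: gauss_def)

lemma abs_gauss [simp]: "\<bar>gauss a x\<bar> = gauss a x"
  by (simp add: gauss_def)

text \<open>The substitution t = c x with pi a c^2 = 1/2 turns the Gaussian into a multiple of the
  standard normal density, so the integral becomes a value of the known characteristic
  function.\<close>

lemma gauss_fourier_real:
  fixes a s :: real
  assumes "a > 0"
  shows "has_bochner_integral lborel (\<lambda>t. complex_of_real (exp (- (pi * a * t\<^sup>2))) * unit_phase (t * s))
    (complex_of_real (exp (- (pi * (1 / a) * s\<^sup>2)) / sqrt a))"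
proof -
  define c where "c = 1 / sqrt (2 * pi * a)"
  have c: "c > 0" "c\<^sup>2 = 1 / (2 * pi * a)"
    using assms by (auto simp: c_def power_divide)
  let ?f = "\<lambda>t. complex_of_real (exp (- (pi * a * t\<^sup>2))) * unit_phase (t * s)"
  let ?g = "\<lambda>x. std_normal_density x *\<^sub>R iexp (2 * pi * c * s * x)"
  have f_eq: "?f (0 + c * x) = complex_of_real (sqrt (2 * pi)) * ?g x" for x
  proof -
    have "pi * a * (c * x)\<^sup>2 = x\<^sup>2 / 2"
      using c assms by (simp add: power_mult_distrib field_simps)
    moreover have "unit_phase (c * x * s) = iexp (2 * pi * c * s * x)"
      by (simp add: unit_phase_def mult_ac)
    ultimately show ?thesis
      by (simp add: std_normal_density_def scaleR_conv_of_real)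
  qed
  interpret std_normal: real_distribution std_normal_distribution
    by (rule real_dist_normal_dist)
  have "integrable std_normal_distribution (\<lambda>x. iexp (2 * pi * c * s * x))"
    by (rule std_normal.integrable_iexp) auto
  then have "integrable lborel ?g"
    by (subst (asm) integrable_density) auto
  then have "integrable lborel (\<lambda>x. ?f (0 + c * x))"
    unfolding f_eq by (rule integrable_mult_right)
  then have int_f: "integrable lborel ?f"
    using c by (subst (asm) lborel_integrable_real_affine_iff) auto
  have "integral\<^sup>L lborel ?g = char std_normal_distribution (2 * pi * c * s)"
    unfolding char_def by (subst integral_density) auto
  also have "\<dots> = complex_of_real (exp (- ((2 * pi * c * s)\<^sup>2) / 2))"
    by (simp add: char_std_normal_distribution)
  also have "(2 * pi * c * s)\<^sup>2 / 2 = pi * (1 / a) * s\<^sup>2"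
    using c(2) assms by (simp add: power_mult_distrib field_simps power2_eq_square)
  then have "exp (- ((2 * pi * c * s)\<^sup>2) / 2) = exp (- (pi * (1 / a) * s\<^sup>2))"
    by simp
  finally have int_g_eq: "integral\<^sup>L lborel ?g = complex_of_real (exp (- (pi * (1 / a) * s\<^sup>2)))" .
  have "integral\<^sup>L lborel ?f = \<bar>c\<bar> *\<^sub>R (LINT x|lborel. ?f (0 + c * x))"
    using c by (intro lborel_integral_real_affine) auto
  also have "\<dots> = complex_of_real (c * sqrt (2 * pi)) * integral\<^sup>L lborel ?g"
    unfolding f_eq using c by (simp add: scaleR_conv_of_real)
  also have "c * sqrt (2 * pi) = 1 / sqrt a"
    by (simp add: c_def real_sqrt_mult)
  finally have "integral\<^sup>L lborel ?f = complex_of_real (1 / sqrt a) * integral\<^sup>L lborel ?g" .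
  then show ?thesis
    using int_f unfolding has_bochner_integral_iff int_g_eq by simp
qed

text \<open>Both the Gaussian and the phase factor over the coordinates, and \<open>lborel\<close>
  is the image of the product of one-dimensional Lebesgue measures, so the real case is multiplied
  over the basis.\<close>

lemma gauss_fourier:
  fixes \<xi> :: "'a::euclidean_space"
  assumes a: "a > 0"
  shows "has_bochner_integral lborel (\<lambda>x. complex_of_real (gauss a x) * unit_phase (x \<bullet> \<xi>))
    (complex_of_real ((1 / sqrt a) ^ DIM('a) * gauss (1 / a) \<xi>))"
proof -
  let ?f = "\<lambda>b t. complex_of_real (exp (- (pi * a * t\<^sup>2))) * unit_phase (t * (\<xi> \<bullet> b))"
  let ?F = "\<lambda>x. complex_of_real (gauss a x) * unit_phase (x \<bullet> \<xi>)"
  let ?T = "\<lambda>f. \<Sum>b\<in>Basis. f b *\<^sub>R b :: 'a"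
  interpret product_sigma_finite "\<lambda>_::'a. lborel :: real measure" ..
  have unit_phase_sum: "unit_phase (sum h B) = (\<Prod>b\<in>B. unit_phase (h b))" if "finite B" for B :: "'a set" and h
    using that by (induction B) (auto simp: unit_phase_add)
  have norm_sum: "(norm x)\<^sup>2 = (\<Sum>b\<in>Basis. (x \<bullet> b)\<^sup>2)" for x :: 'a
    unfolding power2_norm_eq_inner by (subst euclidean_inner) (simp add: power2_eq_square)
  have coord: "?T f \<bullet> b = f b" if "b \<in> Basis" for f b
    using that by (simp add: inner_sum_left inner_Basis if_distrib sum.delta cong: if_cong)
  have gauss_prod: "gauss a' x = (\<Prod>b\<in>Basis. exp (- (pi * a' * (x \<bullet> b)\<^sup>2)))" for a' and x :: 'a
    by (simp add: gauss_def norm_sum sum_distrib_left exp_sum sum_negf[symmetric])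
  have F_T: "?F (?T f) = (\<Prod>b\<in>Basis. ?f b (f b))" for f
  proof -
    have "unit_phase (?T f \<bullet> \<xi>) = (\<Prod>b\<in>Basis. unit_phase (f b * (\<xi> \<bullet> b)))"
      by (subst euclidean_inner) (simp add: unit_phase_sum coord)
    then show ?thesis
      by (simp add: gauss_prod prod.distrib coord)
  qed
  have int: "integrable lborel (?f b)" "integral\<^sup>L lborel (?f b) = complex_of_real (exp (- (pi * (1 / a) * (\<xi> \<bullet> b)\<^sup>2)) / sqrt a)" for b
    using gauss_fourier_real[OF a, of "\<xi> \<bullet> b"] by (auto simp: has_bochner_integral_iff)
  have "integrable (\<Pi>\<^sub>M b\<in>(Basis::'a set). lborel) (\<lambda>f. ?F (?T f))"
    unfolding F_T by (rule product_integrable_prod) (auto intro: int)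
  then have "integrable lborel ?F"
    by (subst lborel_eq, subst integrable_distr_eq) auto
  moreover have "integral\<^sup>L lborel ?F = complex_of_real ((1 / sqrt a) ^ DIM('a) * gauss (1 / a) \<xi>)"
  proof -
    have "integral\<^sup>L lborel ?F = (\<integral>f. ?F (?T f) \<partial>(\<Pi>\<^sub>M b\<in>(Basis::'a set). lborel))"
      by (subst lborel_eq, subst integral_distr) auto
    also have "\<dots> = (\<Prod>b\<in>Basis. integral\<^sup>L lborel (?f b))"
      unfolding F_T by (rule product_integral_prod) (auto intro: int)
    also have "\<dots> = complex_of_real ((1 / sqrt a) ^ DIM('a) * gauss (1 / a) \<xi>)"
      unfolding int(2) gauss_prod by (simp add: prod_dividef power_divide)
    finally show ?thesis .
  qed
  ultimately show ?thesis by (simp add: has_bochner_integral_iff)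
qed

lemma gauss_integrable:
  assumes "a > 0"
  shows "integrable lborel (gauss a :: 'a::euclidean_space \<Rightarrow> real)"
proof -
  have "integrable lborel (\<lambda>x::'a. complex_of_real (gauss a x) * unit_phase (x \<bullet> 0))"
    using gauss_fourier[OF assms, of "0::'a"] by (simp only: has_bochner_integral_iff)
  from integrable_Re[OF this] show ?thesis
    by simp
qed

lemma gauss_L2:
  assumes "a > 0"
  shows "(\<lambda>x. complex_of_real (gauss a x)) \<in> L2"
proof -
  have "(gauss a x)\<^sup>2 = gauss (2 * a) x" for x :: 'a
    by (simp add: gauss_def exp_double[symmetric])
  moreover have "integrable lborel (gauss (2 * a) :: 'a \<Rightarrow> real)"
    using assms by (intro gauss_integrable) auto
  ultimately show ?thesis
    by (simp add: L2_def)
qed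

text \<open>The span of the time-frequency shifts of Gaussians plays the role of the Schwartz space:
  it is dense in \<open>L2\<close>, and the Fourier integral maps it bijectively onto itself.\<close>

inductive_set gabor_span :: "('a::euclidean_space \<Rightarrow> complex) set" where
  shift: "a > 0 \<Longrightarrow> tf_shift m n (\<lambda>x. complex_of_real (gauss a x)) \<in> gabor_span"
| add: "f \<in> gabor_span \<Longrightarrow> g \<in> gabor_span \<Longrightarrow> (\<lambda>x. f x + g x) \<in> gabor_span"
| scale: "f \<in> gabor_span \<Longrightarrow> (\<lambda>x. c * f x) \<in> gabor_span"

lemma gabor_span_integrable: "f \<in> gabor_span \<Longrightarrow> integrable lborel f"
  by (induction rule: gabor_span.induct) (auto intro: tf_shift_integrable gauss_integrable)

lemma gabor_span_L2: "f \<in> gabor_span \<Longrightarrow> f \<in> L2"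
  by (induction rule: gabor_span.induct) (auto intro: tf_shift_L2 gauss_L2)

section \<open>The Fourier integral on the Gabor span\<close>

lemma fourier_kernel_integrable:
  assumes "integrable lborel f"
  shows "integrable lborel (\<lambda>x. f x * unit_phase (x \<bullet> \<xi>))"
proof (rule Bochner_Integration.integrable_bound[OF assms])
  have [measurable]: "f \<in> borel_measurable borel"
    using borel_measurable_integrable[OF assms] by simp
  show "(\<lambda>x. f x * unit_phase (x \<bullet> \<xi>)) \<in> borel_measurable lborel" by simp
qed (simp add: norm_mult)

lemma fourier_integral_add:
  assumes "integrable lborel f" "integrable lborel g"
  shows "fourier_integral (\<lambda>x. f x + g x) = (\<lambda>\<xi>. fourier_integral f \<xi> + fourier_integral g \<xi>)"
  using assms
  by (auto simp: fourier_integral_unit_phase distrib_right Bochner_Integration.integral_add fourier_kernel_integrable)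

lemma fourier_integral_scale: "fourier_integral (\<lambda>x. c * f x) = (\<lambda>\<xi>. c * fourier_integral f \<xi>)"
  by (auto simp: fourier_integral_unit_phase mult.assoc)

lemma fourier_integral_gauss:
  "a > 0 \<Longrightarrow> fourier_integral (\<lambda>x::'a::euclidean_space. complex_of_real (gauss a x)) =
     (\<lambda>\<xi>. complex_of_real ((1 / sqrt a) ^ DIM('a)) * complex_of_real (gauss (1 / a) \<xi>))"
  unfolding fourier_integral_unit_phase
  by (rule ext, subst has_bochner_integral_integral_eq[OF gauss_fourier]) simp_all

lemma fourier_integral_gabor_span: "f \<in> gabor_span \<Longrightarrow> fourier_integral f \<in> gabor_span"
proof (induction rule: gabor_span.induct)
  case (shift a m n)
  then show ?case
    by (simp add: fourier_integral_tf_shift fourier_integral_gauss tf_shift_scale gabor_span.intros)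
next
  case (add f g)
  then show ?case
    by (simp add: fourier_integral_add gabor_span_integrable gabor_span.add)
next
  case (scale f c)
  then show ?case
    by (simp add: fourier_integral_scale gabor_span.scale)
qed

text \<open>On a generator, two transforms send (m, n) to (n, -m) and then to (-m, -n), and the
  width parameter \<open>a\<close> to \<open>1 / a\<close> and back, while phases and normalizations
  cancel. As the Gaussian is even, the outcome is the reflected generator.\<close>

lemma fourier_integral_inversion_gabor_span:
  "f \<in> gabor_span \<Longrightarrow> fourier_integral (fourier_integral f) = (\<lambda>x. f (- x))"
proof (induction rule: gabor_span.induct)
  case (shift a m n)
  have "sqrt a * sqrt (1 / a) = 1"
    using shift by (simp add: real_sqrt_mult[symmetric])
  then have "(1 / sqrt a) ^ DIM('a) * (1 / sqrt (1 / a)) ^ DIM('a) = 1"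
    by (simp add: power_mult_distrib[symmetric])
  then have const: "complex_of_real ((1 / sqrt a) ^ DIM('a)) * complex_of_real ((1 / sqrt (1 / a)) ^ DIM('a)) = 1"
    by (simp only: of_real_mult[symmetric] of_real_1)
  show ?case
  proof
    fix x :: 'a
    have "fourier_integral (fourier_integral (tf_shift m n (\<lambda>x. complex_of_real (gauss a x)))) x =
      complex_of_real ((1 / sqrt a) ^ DIM('a)) * complex_of_real ((1 / sqrt (1 / a)) ^ DIM('a)) *
      (unit_phase (- (m \<bullet> n)) * unit_phase (n \<bullet> m) * tf_shift (- m) (- n) (\<lambda>x. complex_of_real (gauss a x)) x)" for x
    using shift
    by (simp add: fourier_integral_tf_shift fourier_integral_gauss tf_shift_scale fourier_integral_scale
        del: of_real_power of_real_divide)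
    moreover have "unit_phase (- (m \<bullet> n)) * unit_phase (n \<bullet> m) = 1"
    by (simp add: unit_phase_add[symmetric] inner_commute)
  ultimately show "fourier_integral (fourier_integral (tf_shift m n (\<lambda>x. complex_of_real (gauss a x)))) x = tf_shift m n (\<lambda>x. complex_of_real (gauss a x)) (- x)"
    by (simp only: const mult_1_left) (simp add: tf_shift_def gauss_def norm_minus_commute)
  qed
next
  case (add f g)
  then show ?case
    by (simp add: fourier_integral_add gabor_span_integrable fourier_integral_gabor_span)
next
  case (scale f c)
  then show ?case
    by (simp add: fourier_integral_scale)
qed

lemma fourier_integral_surj_gabor_span:
  assumes "f \<in> gabor_span"
  obtains h where "h \<in> gabor_span" "fourier_integral h = f"
proof
  \<comment> \<open>The square of the transform is the reflection, so its fourth power is the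
    identity and its cube is the inverse.\<close>
  let ?h = "fourier_integral (fourier_integral (fourier_integral f))"
  show "?h \<in> gabor_span"
    using assms by (intro fourier_integral_gabor_span)
  have "fourier_integral ?h = (\<lambda>x. fourier_integral (fourier_integral f) (- x))"
    by (intro fourier_integral_inversion_gabor_span fourier_integral_gabor_span assms)
  then show "fourier_integral ?h = f"
    by (simp add: fourier_integral_inversion_gabor_span[OF assms])
qed

lemma fourier_integral_cnj:
  "fourier_integral (\<lambda>x. cnj (f x)) \<xi> = cnj (fourier_integral f (- \<xi>))"
  unfolding fourier_integral_unit_phase
  by (simp add: Bochner_Integration.integral_cnj[symmetric] cnj_unit_phase del: Bochner_Integration.integral_cnj)

text \<open>Fubini for a kernel symmetric in its two arguments. With \<open>g\<close> the conjugate
  of a transform it becomes the Parseval identity.\<close>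

lemma fourier_integral_multiplication:
  fixes f g :: "'a::euclidean_space \<Rightarrow> complex"
  assumes f: "integrable lborel f" and g: "integrable lborel g"
  shows "(LINT x|lborel. fourier_integral f x * g x) = (LINT x|lborel. f x * fourier_integral g x)"
proof -
  have [measurable]: "f \<in> borel_measurable borel" "g \<in> borel_measurable borel"
    using f g by (auto dest: borel_measurable_integrable)
  let ?K = "\<lambda>(x, y). f x * g y * unit_phase (x \<bullet> y)"
  have "integrable (lborel \<Otimes>\<^sub>M lborel) ?K"
  proof (rule lborel_pair.Fubini_integrable)
    show "?K \<in> borel_measurable (lborel \<Otimes>\<^sub>M lborel)" by measurable
    show "integrable lborel (\<lambda>x. \<integral>y. norm (?K (x, y)) \<partial>lborel)"
      using f by (simp add: norm_mult)
    show "AE x in lborel. integrable lborel (\<lambda>y. ?K (x, y))"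
      using fourier_kernel_integrable[OF g] by (simp add: mult.assoc inner_commute)
  qed
  then have "(\<integral>y. (\<integral>x. f x * g y * unit_phase (x \<bullet> y) \<partial>lborel) \<partial>lborel)
      = (\<integral>x. (\<integral>y. f x * g y * unit_phase (x \<bullet> y) \<partial>lborel) \<partial>lborel)"
    by (rule lborel_pair.Fubini_integral)
  moreover have "(\<integral>x. f x * g y * unit_phase (x \<bullet> y) \<partial>lborel) = fourier_integral f y * g y" for y
    unfolding fourier_integral_unit_phase
    by (simp add: mult_ac flip: Bochner_Integration.integral_mult_left_zero Bochner_Integration.integral_mult_right_zero)
  moreover have "(\<integral>y. f x * g y * unit_phase (x \<bullet> y) \<partial>lborel) = f x * fourier_integral g x" for x
    unfolding fourier_integral_unit_phase by (simp add: mult.assoc inner_commute)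
  ultimately show ?thesis by simp
qed

section \<open>Density of the Gabor span\<close>

lemma lborel_integral_affine:
  fixes f :: "'a::euclidean_space \<Rightarrow> 'b::{banach, second_countable_topology}"
  assumes [measurable]: "f \<in> borel_measurable borel" and c: "c \<noteq> 0"
  shows "(LINT x|lborel. f x) = \<bar>c\<bar> ^ DIM('a) *\<^sub>R (LINT x|lborel. f (t + c *\<^sub>R x))"
proof -
  have "(LINT x|lborel. f x) = (LINT x|density (distr lborel borel (\<lambda>x. t + c *\<^sub>R x)) (\<lambda>_. ennreal (\<bar>c\<bar> ^ DIM('a))). f x)"
    using lborel_affine[OF c, of t] by (simp add: ennreal_power)
  also have "\<dots> = (LINT x|distr lborel borel (\<lambda>x. t + c *\<^sub>R x). \<bar>c\<bar> ^ DIM('a) *\<^sub>R f x)"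
    by (rule integral_density) auto
  also have "\<dots> = \<bar>c\<bar> ^ DIM('a) *\<^sub>R (LINT x|lborel. f (t + c *\<^sub>R x))"
    by (subst integral_distr) auto
  finally show ?thesis .
qed

lemma integral_gauss_1: "(LINT x|lborel. gauss 1 (x::'a::euclidean_space)) = 1"
proof -
  have "complex_of_real (LINT x|lborel. gauss 1 (x::'a)) = fourier_integral (\<lambda>x::'a. complex_of_real (gauss 1 x)) 0"
    by (simp add: fourier_integral_unit_phase)
  also have "\<dots> = 1"
    by (simp add: fourier_integral_gauss) (simp add: gauss_def)
  finally show ?thesis by (simp only: of_real_eq_1_iff)
qed

text \<open>The test function \<open>k\<close> is smoothed by convolution with ever narrower
  Gaussians. By Fubini each smoothed function is an average of translated Gaussians and so
  integrates to zero against \<open>F\<close>; dominated convergence passes to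
  \<open>k\<close>.\<close>

lemma gauss_transform_zero_imp_continuous_test:
  fixes F :: "'a::euclidean_space \<Rightarrow> complex" and k :: "'a \<Rightarrow> real"
  assumes F: "integrable lborel F"
    and zero: "\<And>a m. a > 0 \<Longrightarrow> (LINT x|lborel. F x * complex_of_real (gauss a (x + m))) = 0"
    and k: "continuous_on UNIV k" "\<And>x. \<bar>k x\<bar> \<le> B"
  shows "(LINT x|lborel. F x * complex_of_real (k x)) = 0"
proof -
  have [measurable]: "F \<in> borel_measurable borel"
    using borel_measurable_integrable[OF F] by simp
  have [measurable]: "k \<in> borel_measurable borel"
    using k(1) by (rule borel_measurable_continuous_onI)
  have B: "0 \<le> B" using k(2)[of 0] by linarith
  \<comment> \<open>The convolution is written after rescaling, with the fixed weight
    \<open>gauss 1\<close> and the dependence on \<open>n\<close> moved into the argument of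
    \<open>k\<close>: continuity of \<open>k\<close> then gives the limit directly.\<close>
  define \<psi> where "\<psi> n x = (LINT w|lborel. k (x + (1 / real (Suc n)) *\<^sub>R w) * gauss 1 w)" for n x
  have [measurable]: "\<psi> n \<in> borel_measurable borel" for n
    unfolding \<psi>_def[abs_def] by measurable
  have \<psi>_bound: "\<bar>\<psi> n x\<bar> \<le> B" for n x
  proof -
    have "\<bar>\<psi> n x\<bar> \<le> (LINT w|lborel. B * gauss 1 (w::'a))"
      unfolding \<psi>_def
    proof (rule order_trans[OF integral_abs_bound], rule integral_mono)
      show int: "integrable lborel (\<lambda>w. B * gauss 1 (w::'a))"
        by (intro integrable_mult_right gauss_integrable) simp
      show le: "\<bar>k (x + (1 / real (Suc n)) *\<^sub>R w) * gauss 1 w\<bar> \<le> B * gauss 1 w" for w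
        using k(2) gauss_pos[of 1 w] by (auto simp: abs_mult intro!: mult_right_mono)
      show "integrable lborel (\<lambda>w. \<bar>k (x + (1 / real (Suc n)) *\<^sub>R w) * gauss 1 w\<bar>)"
        by (rule Bochner_Integration.integrable_bound[OF int]) (use order_trans[OF le abs_ge_self] in auto)
    qed
    then show ?thesis by (simp add: integral_gauss_1)
  qed
  have \<psi>_limit: "(\<lambda>n. \<psi> n x) \<longlonglongrightarrow> k x" for x
  proof -
    have "(\<lambda>n. \<psi> n x) \<longlonglongrightarrow> (LINT w|lborel. k x * gauss 1 (w::'a))"
      unfolding \<psi>_def
    proof (rule integral_dominated_convergence[where w = "\<lambda>w. B * gauss 1 w"])
      show "integrable lborel (\<lambda>w. B * gauss 1 (w::'a))"
        by (intro integrable_mult_right gauss_integrable) simp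
      show "AE w in lborel. norm (k (x + (1 / real (Suc n)) *\<^sub>R w) * gauss 1 w) \<le> B * gauss 1 w" for n
        using k(2) by (auto simp: abs_mult less_imp_le intro!: mult_right_mono)
      have "(\<lambda>n. k (x + (1 / real (Suc n)) *\<^sub>R w)) \<longlonglongrightarrow> k (x + 0 *\<^sub>R w)" for w
        by (intro isCont_tendsto_compose[of _ k] tendsto_intros LIMSEQ_Suc[OF lim_1_over_n])
          (use k(1) in \<open>auto simp: continuous_on_eq_continuous_at\<close>)
      then show "AE w in lborel. (\<lambda>n. k (x + (1 / real (Suc n)) *\<^sub>R w) * gauss 1 w) \<longlonglongrightarrow> k x * gauss 1 w"
        by (auto intro!: tendsto_intros)
    qed measurable
    then show ?thesis by (simp add: integral_gauss_1)
  qed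
  have \<psi>_zero: "(LINT x|lborel. F x * complex_of_real (\<psi> n x)) = 0" for n
  proof -
    \<comment> \<open>This width makes \<open>gauss a\<close> at \<open>w / (n + 1)\<close> equal to
      \<open>gauss 1 w\<close>, so that undoing the rescaling turns \<open>\<psi> n\<close> into a
      genuine convolution.\<close>
    define a where "a = (real (Suc n))\<^sup>2"
    have a: "a > 0" by (simp add: a_def)
    let ?G = "\<lambda>(x, m). F x * complex_of_real (gauss a (m - x))"
    let ?K = "\<lambda>(x, m). F x * complex_of_real (k m * gauss a (m - x))"
    have shift: "integrable lborel (\<lambda>m. gauss a (m - x))" "(LINT m|lborel. gauss a (m - x)) = (LINT m|lborel. gauss a (m :: 'a))" for x :: 'a
      using lborel_integrable_shift_iff[of "gauss a" "- x"] lborel_integral_shift[of "gauss a" "- x"] gauss_integrable[OF a]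
      by auto
    have "integrable (lborel \<Otimes>\<^sub>M lborel) ?G"
    proof (rule lborel_pair.Fubini_integrable)
      show "?G \<in> borel_measurable (lborel \<Otimes>\<^sub>M lborel)" by measurable
      show "integrable lborel (\<lambda>x. \<integral>m. norm (?G (x, m)) \<partial>lborel)"
        using F by (simp add: norm_mult shift(2) less_imp_le)
      show "AE x in lborel. integrable lborel (\<lambda>m. ?G (x, m))"
        using shift(1) by auto
    qed
    then have "integrable (lborel \<Otimes>\<^sub>M lborel) (\<lambda>p. complex_of_real B * ?G p)"
      by (rule integrable_mult_right)
    then have "integrable (lborel \<Otimes>\<^sub>M lborel) ?K"
    proof (rule Bochner_Integration.integrable_bound)
      have "\<bar>k m\<bar> * (cmod (F x) * gauss a (m - x)) \<le> B * (cmod (F x) * gauss a (m - x))" for x m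
        using k(2) by (intro mult_right_mono) (auto simp: less_imp_le)
      then show "AE p in lborel \<Otimes>\<^sub>M lborel. norm (?K p) \<le> norm (complex_of_real B * ?G p)"
        using B by (intro AE_I2) (auto simp: norm_mult abs_mult less_imp_le mult_ac)
    qed measurable
    then have "(\<integral>m. (\<integral>x. F x * complex_of_real (k m * gauss a (m - x)) \<partial>lborel) \<partial>lborel)
        = (\<integral>x. (\<integral>m. F x * complex_of_real (k m * gauss a (m - x)) \<partial>lborel) \<partial>lborel)"
      by (rule lborel_pair.Fubini_integral)
    moreover have "(\<integral>x. F x * complex_of_real (k m * gauss a (m - x)) \<partial>lborel) = 0" for m
    proof -
      have "(\<integral>x. F x * complex_of_real (k m * gauss a (m - x)) \<partial>lborel)
          = (\<integral>x. complex_of_real (k m) * (F x * complex_of_real (gauss a (x + - m))) \<partial>lborel)"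
        by (intro Bochner_Integration.integral_cong) (auto simp: gauss_def norm_minus_commute)
      also have "\<dots> = 0"
        using zero[OF a, of "- m"] by (subst integral_mult_right_zero) simp
      finally show ?thesis .
    qed
    moreover have "(\<integral>m. F x * complex_of_real (k m * gauss a (m - x)) \<partial>lborel)
        = complex_of_real ((1 / real (Suc n)) ^ DIM('a)) * (F x * complex_of_real (\<psi> n x))" for x
    proof -
      have "(\<integral>m. k m * gauss a (m - x) \<partial>lborel) = (1 / real (Suc n)) ^ DIM('a) *
          (\<integral>w. k (x + (1 / real (Suc n)) *\<^sub>R w) * gauss a (x + (1 / real (Suc n)) *\<^sub>R w - x) \<partial>lborel)"
        by (subst lborel_integral_affine[where c = "1 / real (Suc n)" and t = x]) auto
      moreover have "gauss a (x + (1 / real (Suc n)) *\<^sub>R w - x) = gauss 1 w" for w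
        by (simp add: gauss_def a_def power_divide)
      ultimately have "(\<integral>m. k m * gauss a (m - x) \<partial>lborel) = (1 / real (Suc n)) ^ DIM('a) * \<psi> n x"
        by (simp add: \<psi>_def)
      moreover have "(\<integral>m. F x * complex_of_real (k m * gauss a (m - x)) \<partial>lborel)
          = F x * complex_of_real (\<integral>m. k m * gauss a (m - x) \<partial>lborel)"
        by (simp only: integral_mult_right_zero integral_complex_of_real)
      ultimately show ?thesis by simp
    qed
    ultimately have "0 = (\<integral>x. complex_of_real ((1 / real (Suc n)) ^ DIM('a)) * (F x * complex_of_real (\<psi> n x)) \<partial>lborel)"
      by (simp only: Bochner_Integration.integral_zero)
    then have "0 = complex_of_real ((1 / real (Suc n)) ^ DIM('a)) * (LINT x|lborel. F x * complex_of_real (\<psi> n x))"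
      by (simp only: integral_mult_right_zero)
    moreover have "complex_of_real ((1 / real (Suc n)) ^ DIM('a)) \<noteq> 0"
      unfolding of_real_eq_0_iff by simp
    ultimately show ?thesis
      by (metis mult_eq_0_iff)
  qed
  have "(\<lambda>n. LINT x|lborel. F x * complex_of_real (\<psi> n x)) \<longlonglongrightarrow> (LINT x|lborel. F x * complex_of_real (k x))"
  proof (rule integral_dominated_convergence[where w = "\<lambda>x. B * cmod (F x)"])
    show "integrable lborel (\<lambda>x. B * cmod (F x))"
      using F by simp
    show "AE x in lborel. norm (F x * complex_of_real (\<psi> n x)) \<le> B * cmod (F x)" for n
      using \<psi>_bound[of n] by (auto simp: norm_mult mult.commute[of B] intro!: mult_left_mono)
    show "AE x in lborel. (\<lambda>n. F x * complex_of_real (\<psi> n x)) \<longlonglongrightarrow> F x * complex_of_real (k x)"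
      using \<psi>_limit by (auto intro!: tendsto_intros)
  qed measurable
  then show ?thesis
    by (simp add: \<psi>_zero LIMSEQ_const_iff)
qed

text \<open>Cut-offs \<open>min 1 (n * infdist x (- U))\<close> increase to the indicator of an open
  set \<open>U\<close>, so the integral of \<open>F\<close> over \<open>U\<close> vanishes. The sets
  with vanishing integral form a Dynkin class, hence include all Borel sets, and \<open>F\<close> is
  null.\<close>

lemma continuous_test_zero_imp_AE_zero:
  fixes F :: "'a::euclidean_space \<Rightarrow> complex"
  assumes F: "integrable lborel F"
    and zero: "\<And>k B. continuous_on UNIV k \<Longrightarrow> (\<And>x. \<bar>k x\<bar> \<le> B) \<Longrightarrow>
      (LINT x|lborel. F x * complex_of_real (k x)) = 0"
  shows "AE x in lborel. F x = 0"
proof -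
  have [measurable]: "F \<in> borel_measurable borel"
    using borel_measurable_integrable[OF F] by simp
  have total: "(LINT x|lborel. F x) = 0"
    using zero[of "\<lambda>_. 1" 1] by simp
  have set_int: "set_integrable lborel A F" if "A \<in> sets borel" for A
    unfolding set_integrable_def by (rule integrable_mult_indicator) (use F that in auto)
  have "set_lebesgue_integral lborel A F = 0" if A: "A \<in> sets lborel" for A
  proof -
    have "Int_stable {S :: 'a set. open S}"
      by (auto simp: Int_stable_def)
    moreover have "{S :: 'a set. open S} \<subseteq> Pow UNIV" by simp
    moreover have "A \<in> sigma_sets UNIV {S. open S}"
      using A by (simp add: sets_borel)
    ultimately show ?thesis
    proof (induction rule: sigma_sets_induct_disjoint)
      case (basic U)
      show ?case
      \<comment> \<open>The whole space is separated because \<open>infdist x {}\<close> is 0 by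
        convention, so the cut-offs would vanish identically there.\<close>
      proof (cases "U = UNIV")
        case True
        then show ?thesis by (simp add: set_lebesgue_integral_def total)
      next
        case False
        let ?k = "\<lambda>n x. min 1 (real n * infdist x (- U))"
        have U: "open U" using basic by simp
        have [measurable]: "?k n \<in> borel_measurable borel" for n
          by (intro borel_measurable_continuous_onI continuous_intros)
        have indicator_limit: "(\<lambda>n. ?k n x) \<longlonglongrightarrow> indicator U x" for x
        proof (cases "x \<in> U")
          case True
          then have pos: "infdist x (- U) > 0"
            using U False in_closed_iff_infdist_zero[of "- U" x] infdist_nonneg[of x "- U"]
            by (auto simp: closed_Compl less_le)
          obtain N where N: "1 < real N * infdist x (- U)"
            using reals_Archimedean3[OF pos] by auto
          have "?k n x = 1" if "n \<ge> N" for n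
          proof -
            have "real N * infdist x (- U) \<le> real n * infdist x (- U)"
              using that by (intro mult_right_mono) (auto simp: infdist_nonneg)
            with N show ?thesis by simp
          qed
          then have "eventually (\<lambda>n. ?k n x = 1) sequentially"
            by (auto simp: eventually_sequentially)
          then show ?thesis
            using True by (simp add: tendsto_eventually)
        qed simp
        have "(\<lambda>n. LINT x|lborel. F x * complex_of_real (?k n x)) \<longlonglongrightarrow> (LINT x|lborel. indicator U x *\<^sub>R F x)"
        proof (rule integral_dominated_convergence[where w = "\<lambda>x. cmod (F x)"])
          have [measurable]: "U \<in> sets borel" using U by simp
          show "(\<lambda>x. indicator U x *\<^sub>R F x) \<in> borel_measurable lborel"
            by measurable
          show "integrable lborel (\<lambda>x. cmod (F x))"
            using F by simp
          show "AE x in lborel. norm (F x * complex_of_real (?k n x)) \<le> cmod (F x)" for n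
            by (auto simp: norm_mult infdist_nonneg intro!: mult_left_le)
          show "AE x in lborel. (\<lambda>n. F x * complex_of_real (?k n x)) \<longlonglongrightarrow> indicator U x *\<^sub>R F x"
          proof (rule AE_I2)
            fix x
            have "(\<lambda>n. F x * complex_of_real (?k n x)) \<longlonglongrightarrow> F x * complex_of_real (indicator U x)"
              by (intro tendsto_intros indicator_limit)
            then show "(\<lambda>n. F x * complex_of_real (?k n x)) \<longlonglongrightarrow> indicator U x *\<^sub>R F x"
              by (simp add: scaleR_conv_of_real mult.commute)
          qed
        qed measurable
        moreover have "(LINT x|lborel. F x * complex_of_real (?k n x)) = 0" for n
          by (rule zero[where B = 1]) (auto intro!: continuous_intros simp: infdist_nonneg)
        ultimately show ?thesis
          by (simp add: set_lebesgue_integral_def LIMSEQ_const_iff)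
      qed
    next
      case empty
      then show ?case by (simp add: set_lebesgue_integral_def)
    next
      case (compl A)
      then have A: "A \<in> sets borel" by (simp add: sets_borel)
      have "(LINT x|lborel. F x) = (LINT x|lborel. indicator A x *\<^sub>R F x + indicator (UNIV - A) x *\<^sub>R F x)"
        by (intro Bochner_Integration.integral_cong) (auto simp: indicator_def)
      also have "\<dots> = set_lebesgue_integral lborel A F + set_lebesgue_integral lborel (UNIV - A) F"
        unfolding set_lebesgue_integral_def using set_int[OF A] set_int[of "UNIV - A"] A
        by (intro Bochner_Integration.integral_add) (auto simp: set_integrable_def)
      finally show ?case using compl total by simp
    next
      case (union A)
      then have A: "range A \<subseteq> sets borel" by (auto simp: sets_borel)
      have "set_lebesgue_integral lborel (\<Union>i. A i) F = (\<Sum>i. set_lebesgue_integral lborel (A i) F)"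
      proof (rule lebesgue_integral_countable_add)
        show "A i \<in> sets lborel" for i using A by auto
        show "A i \<inter> A j = {}" if "i \<noteq> j" for i j
          using union that by (auto simp: disjoint_family_on_def)
        show "set_integrable lborel (\<Union>i. A i) F"
          using A by (intro set_int) auto
      qed
      then show ?case using union by simp
    qed
  qed
  then show ?thesis
    by (rule sigma_finite_measure.density_zero[OF sigma_finite_lborel F])
qed

text \<open>A function in \<open>L2\<close> need not be integrable, so the weight
  \<open>gauss 1\<close> is put in first. A Gaussian times this weight is, after completing the
  square, a multiple of a Gaussian centred at \<open>- m'\<close>, hence again in the span:
  orthogonality of \<open>f\<close> therefore says that the integrals of \<open>F\<close> against
  all translated Gaussians vanish.\<close>

lemma gabor_span_complement:
  fixes f :: "'a::euclidean_space \<Rightarrow> complex"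
  assumes f: "f \<in> L2" and orth: "\<And>v. v \<in> gabor_span \<Longrightarrow> L2_inner f v = 0"
  shows "AE x in lborel. f x = 0"
proof -
  define F where "F x = f x * complex_of_real (gauss 1 x)" for x
  have F: "integrable lborel F"
    unfolding F_def using f by (intro L2_product_integrable gauss_L2) auto
  have gauss_zero: "(LINT x|lborel. F x * complex_of_real (gauss a (x + m))) = 0" if a: "a > 0" for a m
  proof -
    define m' where "m' = (a / (1 + a)) *\<^sub>R m"
    have completed_square: "(norm x)\<^sup>2 + a * (norm (x + m))\<^sup>2 = (1 + a) * (norm (x + m'))\<^sup>2 + a / (1 + a) * (norm m)\<^sup>2" for x
    proof -
      have "(1 + a) * (norm (x + m'))\<^sup>2 = (1 + a) * (x \<bullet> x) + 2 * ((1 + a) * (a / (1 + a))) * (x \<bullet> m) +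
          (1 + a) * (a / (1 + a)) * (a / (1 + a)) * (m \<bullet> m)"
        unfolding power2_norm_eq_inner m'_def
        by (simp add: inner_add_left inner_add_right inner_commute algebra_simps)
      also have "(1 + a) * (a / (1 + a)) = a" using a by simp
      finally have "(1 + a) * (norm (x + m'))\<^sup>2 + a / (1 + a) * (norm m)\<^sup>2
          = (1 + a) * (x \<bullet> x) + 2 * a * (x \<bullet> m) + (a * a + a) / (1 + a) * (m \<bullet> m)"
        by (simp add: power2_norm_eq_inner add_divide_distrib algebra_simps)
      also have "(a * a + a) / (1 + a) = a" using a by (simp add: field_simps)
      finally show ?thesis
        unfolding power2_norm_eq_inner by (simp add: inner_add_left inner_add_right inner_commute algebra_simps)
    qed
    have "gauss 1 x * gauss a (x + m) = exp (- (pi * (a / (1 + a)) * (norm m)\<^sup>2)) * gauss (1 + a) (x + m')" for x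
    proof -
      have "gauss 1 x * gauss a (x + m) = exp (- (pi * ((norm x)\<^sup>2 + a * (norm (x + m))\<^sup>2)))"
        by (simp add: gauss_def exp_add[symmetric] algebra_simps)
      also have "\<dots> = exp (- (pi * (a / (1 + a)) * (norm m)\<^sup>2)) * gauss (1 + a) (x + m')"
        unfolding completed_square by (simp add: gauss_def exp_add[symmetric] algebra_simps)
      finally show ?thesis .
    qed
    then have "F x * complex_of_real (gauss a (x + m)) =
        complex_of_real (exp (- (pi * (a / (1 + a)) * (norm m)\<^sup>2))) *
        (f x * cnj (tf_shift m' 0 (\<lambda>x. complex_of_real (gauss (1 + a) x)) x))" for x
      by (simp add: F_def tf_shift_def mult.assoc flip: of_real_mult)
    then have "(LINT x|lborel. F x * complex_of_real (gauss a (x + m))) =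
        complex_of_real (exp (- (pi * (a / (1 + a)) * (norm m)\<^sup>2))) *
        L2_inner f (tf_shift m' 0 (\<lambda>x. complex_of_real (gauss (1 + a) x)))"
      by (simp only: L2_inner_def integral_mult_right_zero)
    also have "\<dots> = 0"
      using a by (simp add: orth gabor_span.shift)
    finally show ?thesis .
  qed
  have "AE x in lborel. F x = 0"
  proof (rule continuous_test_zero_imp_AE_zero[OF F])
    fix k :: "'a \<Rightarrow> real" and B :: real
    assume "continuous_on UNIV k" "\<And>x. \<bar>k x\<bar> \<le> B"
    then show "(LINT x|lborel. F x * complex_of_real (k x)) = 0"
      using gauss_transform_zero_imp_continuous_test[OF F gauss_zero] by blast
  qed
  then show ?thesis
    by eventually_elim (use gauss_pos[of 1] in \<open>auto simp: F_def less_le\<close>)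
qed

lemma gabor_span_dense:
  assumes "f \<in> L2"
  obtains u where "\<And>k. u k \<in> gabor_span" "L2_tendsto u f"
proof (rule L2_dense_of_trivial_complement[of gabor_span f])
  show "(gabor_span :: ('a \<Rightarrow> complex) set) \<noteq> {}"
    using gabor_span.shift[of 1 0 0] by auto
qed (use assms that in \<open>auto intro: gabor_span_L2 gabor_span.intros gabor_span_complement\<close>)

section \<open>The Fourier transform on L2\<close>

lemma gabor_span_diff: "f \<in> gabor_span \<Longrightarrow> g \<in> gabor_span \<Longrightarrow> (\<lambda>x. f x - g x) \<in> gabor_span"
  using gabor_span.add[of f "\<lambda>x. (-1) * g x"] gabor_span.scale[of g "-1"] by simp

text \<open>The approximants in \<open>is_fourier_L2\<close> are arbitrary functions for which no
  inversion formula is at hand. It is enough to invert on the side of \<open>v\<close>, after the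
  multiplication formula has moved both transforms there.\<close>

lemma L2_inner_fourier_integral_gabor_span:
  assumes u: "integrable lborel u" and v: "v \<in> gabor_span"
  shows "L2_inner (fourier_integral u) (fourier_integral v) = L2_inner u v"
proof -
  have "integrable lborel (\<lambda>x. cnj (fourier_integral v x))"
    using v by (intro integrable_cnj gabor_span_integrable fourier_integral_gabor_span)
  then have "L2_inner (fourier_integral u) (fourier_integral v)
      = (LINT x|lborel. u x * fourier_integral (\<lambda>x. cnj (fourier_integral v x)) x)"
    unfolding L2_inner_def by (rule fourier_integral_multiplication[OF u])
  also have "\<dots> = L2_inner u v"
    unfolding L2_inner_def fourier_integral_cnj fourier_integral_inversion_gabor_span[OF v] by simp
  finally show ?thesis .
qed

lemma L2_norm_fourier_integral_gabor_span:
  assumes "v \<in> gabor_span"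
  shows "L2_norm (fourier_integral v) = L2_norm v"
proof -
  have "(L2_norm (fourier_integral v))\<^sup>2 = (L2_norm v)\<^sup>2"
    using L2_inner_fourier_integral_gabor_span[OF gabor_span_integrable[OF assms] assms]
    unfolding L2_inner_self of_real_eq_iff .
  then show ?thesis by simp
qed

lemma is_fourier_L2_in_L2: "is_fourier_L2 f h \<Longrightarrow> f \<in> L2" "is_fourier_L2 f h \<Longrightarrow> h \<in> L2"
  by (auto simp: is_fourier_L2_def L2_tendsto_def)

lemma is_fourier_L2_inner_gabor_span:
  assumes "is_fourier_L2 f h" and v: "v \<in> gabor_span"
  shows "L2_inner h (fourier_integral v) = L2_inner f v"
proof -
  obtain u where u: "\<And>k. integrable lborel (u k)" "L2_tendsto u f" "L2_tendsto (\<lambda>k. fourier_integral (u k)) h"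
    using assms(1) by (auto simp: is_fourier_L2_def)
  have v_L2: "v \<in> L2" "fourier_integral v \<in> L2"
    using v by (auto intro: gabor_span_L2 fourier_integral_gabor_span)
  have "(\<lambda>k. L2_inner (fourier_integral (u k)) (fourier_integral v)) \<longlonglongrightarrow> L2_inner h (fourier_integral v)"
    by (intro L2_tendsto_inner u L2_tendsto_const v_L2)
  moreover have "(\<lambda>k. L2_inner (u k) v) \<longlonglongrightarrow> L2_inner f v"
    by (intro L2_tendsto_inner u L2_tendsto_const v_L2)
  ultimately show ?thesis
    using L2_inner_fourier_integral_gabor_span[OF u(1) v] by (simp add: LIMSEQ_unique)
qed

text \<open>Every element of the span is the transform of some \<open>v\<close> in the span, and
  pairing a transform with it gives back the pairing of the original function with \<open>v\<close>.
  Hence \<open>h - h'\<close> is orthogonal to the whole span.\<close>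

lemma is_fourier_L2_unique:
  assumes f: "is_fourier_L2 f h" and f': "is_fourier_L2 f' h'" and eq: "AE x in lborel. f x = f' x"
  shows "AE x in lborel. h x = h' x"
proof -
  note L2 = is_fourier_L2_in_L2[OF f] is_fourier_L2_in_L2[OF f']
  have "L2_inner (\<lambda>x. h x - h' x) w = 0" if w: "w \<in> gabor_span" for w
  proof -
    obtain v where v: "v \<in> gabor_span" "w = fourier_integral v"
      using fourier_integral_surj_gabor_span[OF w] by metis
    have "L2_inner f v = L2_inner f' v"
      using gabor_span_L2[OF v(1)] by (intro L2_inner_AE_cong[OF eq] L2)
    moreover have "L2_inner (\<lambda>x. h x - h' x) w = L2_inner h w - L2_inner h' w"
      using gabor_span_L2[OF w] by (intro L2_inner_diff_left L2)
    ultimately show ?thesis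
      using v f f' by (simp add: is_fourier_L2_inner_gabor_span)
  qed
  then have "AE x in lborel. h x - h' x = 0"
    using L2 by (intro gabor_span_complement) auto
  then show ?thesis by simp
qed

lemma L2_tendsto_imp_Cauchy:
  assumes "L2_tendsto u f" "e > 0"
  shows "\<exists>N. \<forall>m\<ge>N. \<forall>n\<ge>N. L2_norm (\<lambda>x. u m x - u n x) < e"
proof -
  have L2: "u k \<in> L2" "f \<in> L2" for k
    using assms by (auto simp: L2_tendsto_def)
  have "eventually (\<lambda>k. L2_norm (\<lambda>x. u k x - f x) < e / 2) sequentially"
    using assms by (intro order_tendstoD(2)) (auto simp: L2_tendsto_def)
  then obtain N where N: "\<And>k. k \<ge> N \<Longrightarrow> L2_norm (\<lambda>x. u k x - f x) < e / 2"
    by (auto simp: eventually_sequentially)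
  have "L2_norm (\<lambda>x. u m x - u n x) < e" if "m \<ge> N" "n \<ge> N" for m n
    using L2_dist_triangle[OF L2(1) L2(2) L2(1), of m n] N[OF that(1)] N[OF that(2)]
      L2_norm_minus_commute[of f "u n"] by linarith
  then show ?thesis by blast
qed

lemma L2_dist_fourier_integral_gabor_span:
  assumes "u \<in> gabor_span" "v \<in> gabor_span"
  shows "L2_norm (\<lambda>x. fourier_integral u x - fourier_integral v x) = L2_norm (\<lambda>x. u x - v x)"
proof -
  have "fourier_integral (\<lambda>x. u x + (-1) * v x) = (\<lambda>x. fourier_integral u x + (-1) * fourier_integral v x)"
    using assms by (simp only: fourier_integral_add fourier_integral_scale integrable_mult_right gabor_span_integrable)
  then have "(\<lambda>x. fourier_integral u x - fourier_integral v x) = fourier_integral (\<lambda>x. u x - v x)"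
    by simp
  then show ?thesis
    by (simp only: L2_norm_fourier_integral_gabor_span gabor_span_diff assms)
qed

lemma gabor_span_fourier_convergent:
  assumes u: "\<And>k. u k \<in> gabor_span" and lim: "L2_tendsto u f"
  obtains h where "L2_tendsto (\<lambda>k. fourier_integral (u k)) h"
proof (rule L2_complete[of "\<lambda>k. fourier_integral (u k)"])
  show "fourier_integral (u k) \<in> L2" for k
    by (intro gabor_span_L2 fourier_integral_gabor_span u)
  fix e :: real assume "e > 0"
  show "\<exists>N. \<forall>m\<ge>N. \<forall>n\<ge>N. L2_norm (\<lambda>x. fourier_integral (u m) x - fourier_integral (u n) x) < e"
    using L2_tendsto_imp_Cauchy[OF lim \<open>e > 0\<close>] by (simp add: L2_dist_fourier_integral_gabor_span u)
qed (rule that)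

lemma is_fourier_L2_exists:
  assumes "f \<in> L2"
  shows "\<exists>h. is_fourier_L2 f h"
proof -
  obtain u where u: "\<And>k. u k \<in> gabor_span" "L2_tendsto u f"
    using gabor_span_dense[OF assms] by blast
  then show ?thesis
    using gabor_span_fourier_convergent[OF u] gabor_span_integrable[OF u(1)]
    by (metis is_fourier_L2_def)
qed

lemma is_fourier_L2_AE_cong:
  assumes "is_fourier_L2 f h" "AE x in lborel. h x = h' x" "h' \<in> L2"
  shows "is_fourier_L2 f h'"
  using assms(1) L2_tendsto_AE_cong[OF _ assms(2,3)] unfolding is_fourier_L2_def by blast

text \<open>The transform is isometric and surjective on the span, so preimages of a sequence
  approximating \<open>h\<close> are again Cauchy.\<close>

lemma is_fourier_L2_surj:
  assumes "h \<in> L2"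
  shows "\<exists>f. is_fourier_L2 f h"
proof -
  obtain w where w: "\<And>k. w k \<in> gabor_span" "L2_tendsto w h"
    using gabor_span_dense[OF assms] by blast
  have "\<exists>u. u \<in> gabor_span \<and> fourier_integral u = w k" for k
    using fourier_integral_surj_gabor_span[OF w(1)] by metis
  then obtain u where u: "\<And>k. u k \<in> gabor_span" "\<And>k. fourier_integral (u k) = w k"
    by metis
  have "\<exists>N. \<forall>m\<ge>N. \<forall>n\<ge>N. L2_norm (\<lambda>x. u m x - u n x) < e" if "e > 0" for e
    using L2_tendsto_imp_Cauchy[OF w(2) that] L2_dist_fourier_integral_gabor_span[OF u(1) u(1)] by (simp add: u(2))
  then obtain f where "L2_tendsto u f"
    using L2_complete[of u] gabor_span_L2[OF u(1)] by blast
  then have "is_fourier_L2 f h"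
    using u w gabor_span_integrable by (auto simp: is_fourier_L2_def intro!: exI[of _ u])
  then show ?thesis by blast
qed

lemma is_fourier_L2_inner:
  assumes f: "is_fourier_L2 f h" and f': "is_fourier_L2 f' h'"
  shows "L2_inner h h' = L2_inner f f'"
proof -
  note L2 = is_fourier_L2_in_L2[OF f] is_fourier_L2_in_L2[OF f']
  obtain u where u: "\<And>k. u k \<in> gabor_span" "L2_tendsto u f'"
    using gabor_span_dense[OF L2(3)] by blast
  obtain h'' where h'': "L2_tendsto (\<lambda>k. fourier_integral (u k)) h''"
    using gabor_span_fourier_convergent[OF u] by blast
  \<comment> \<open>The sequence behind \<open>h'\<close> need not consist of elements of the span,
    so \<open>h'\<close> is first exchanged for a limit of transforms from the span; by uniqueness
    the two agree almost everywhere.\<close>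
  have "is_fourier_L2 f' h''"
    using u h'' gabor_span_integrable by (auto simp: is_fourier_L2_def)
  from is_fourier_L2_unique[OF this f'] have "AE x in lborel. h'' x = h' x" by simp
  from L2_tendsto_AE_cong[OF h'' this L2(4)]
  have "(\<lambda>k. L2_inner h (fourier_integral (u k))) \<longlonglongrightarrow> L2_inner h h'"
    by (intro L2_tendsto_inner L2_tendsto_const L2)
  moreover have "(\<lambda>k. L2_inner f (u k)) \<longlonglongrightarrow> L2_inner f f'"
    by (intro L2_tendsto_inner L2_tendsto_const L2 u)
  ultimately show ?thesis
    using is_fourier_L2_inner_gabor_span[OF f u(1)] by (simp add: LIMSEQ_unique)
qed

lemma is_fourier_L2_norm:
  assumes "is_fourier_L2 f h"
  shows "L2_norm h = L2_norm f"
proof -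
  have "(L2_norm h)\<^sup>2 = (L2_norm f)\<^sup>2"
    using is_fourier_L2_inner[OF assms assms] unfolding L2_inner_self of_real_eq_iff .
  then show ?thesis by simp
qed

text \<open>The relation is linear and compatible with shifts on the nose, whereas the chosen
  representative \<open>fourier_L2\<close> is so only almost everywhere. The remaining argument
  therefore computes with the relation.\<close>

lemma is_fourier_L2_scale:
  assumes "is_fourier_L2 f h"
  shows "is_fourier_L2 (\<lambda>x. c * f x) (\<lambda>x. c * h x)"
proof -
  obtain u where "\<And>k. integrable lborel (u k)" "L2_tendsto u f" "L2_tendsto (\<lambda>k. fourier_integral (u k)) h"
    using assms by (auto simp: is_fourier_L2_def)
  then show ?thesis
    unfolding is_fourier_L2_def
    by (intro exI[of _ "\<lambda>k x. c * u k x"]) (auto intro: L2_tendsto_scale simp: fourier_integral_scale)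
qed

lemma is_fourier_L2_add:
  assumes "is_fourier_L2 f h" "is_fourier_L2 f' h'"
  shows "is_fourier_L2 (\<lambda>x. f x + f' x) (\<lambda>x. h x + h' x)"
proof -
  obtain u where "\<And>k. integrable lborel (u k)" "L2_tendsto u f" "L2_tendsto (\<lambda>k. fourier_integral (u k)) h"
    using assms by (auto simp: is_fourier_L2_def)
  moreover obtain u' where "\<And>k. integrable lborel (u' k)" "L2_tendsto u' f'" "L2_tendsto (\<lambda>k. fourier_integral (u' k)) h'"
    using assms by (auto simp: is_fourier_L2_def)
  ultimately show ?thesis
    unfolding is_fourier_L2_def
    by (intro exI[of _ "\<lambda>k x. u k x + u' k x"]) (auto intro: L2_tendsto_add simp: fourier_integral_add)
qed

lemma is_fourier_L2_diff:
  "is_fourier_L2 f h \<Longrightarrow> is_fourier_L2 f' h' \<Longrightarrow> is_fourier_L2 (\<lambda>x. f x - f' x) (\<lambda>x. h x - h' x)"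
  using is_fourier_L2_add[of f h "\<lambda>x. (-1) * f' x" "\<lambda>x. (-1) * h' x"] is_fourier_L2_scale[of f' h' "-1"]
  by simp

lemma is_fourier_L2_tf_shift:
  assumes "is_fourier_L2 f h"
  shows "is_fourier_L2 (tf_shift m n f) (\<lambda>\<xi>. unit_phase (- (m \<bullet> n)) * tf_shift n (- m) h \<xi>)"
proof -
  obtain u where u: "\<And>k. integrable lborel (u k)" "L2_tendsto u f" "L2_tendsto (\<lambda>k. fourier_integral (u k)) h"
    using assms by (auto simp: is_fourier_L2_def)
  have "fourier_integral (tf_shift m n (u k)) = (\<lambda>\<xi>. unit_phase (- (m \<bullet> n)) * tf_shift n (- m) (fourier_integral (u k)) \<xi>)" for k
    using borel_measurable_integrable[OF u(1)] by (intro fourier_integral_tf_shift) simp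
  then show ?thesis
    unfolding is_fourier_L2_def using u
    by (intro exI[of _ "\<lambda>k. tf_shift m n (u k)"])
      (auto intro: tf_shift_integrable L2_tendsto_tf_shift L2_tendsto_scale)
qed

lemma fourier_L2: "f \<in> L2 \<Longrightarrow> is_fourier_L2 f (fourier_L2 f)"
  unfolding fourier_L2_def by (rule someI_ex[OF is_fourier_L2_exists])

lemma inv_fourier_L2:
  assumes "h \<in> L2"
  shows "is_fourier_L2 (inv_fourier_L2 h) h"
proof -
  obtain f where f: "is_fourier_L2 f h"
    using is_fourier_L2_surj[OF assms] by blast
  then have L2: "f \<in> L2" by (rule is_fourier_L2_in_L2)
  have "AE \<xi> in lborel. fourier_L2 f \<xi> = h \<xi>"
    using is_fourier_L2_unique[OF fourier_L2[OF L2] f] by simp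
  with L2 have "\<exists>f. f \<in> L2 \<and> (AE \<xi> in lborel. fourier_L2 f \<xi> = h \<xi>)"
    by blast
  then have "inv_fourier_L2 h \<in> L2 \<and> (AE \<xi> in lborel. fourier_L2 (inv_fourier_L2 h) \<xi> = h \<xi>)"
    unfolding inv_fourier_L2_def by (rule someI_ex)
  then have inv: "inv_fourier_L2 h \<in> L2" "AE \<xi> in lborel. fourier_L2 (inv_fourier_L2 h) \<xi> = h \<xi>"
    by simp_all
  show ?thesis
    by (rule is_fourier_L2_AE_cong[OF fourier_L2[OF inv(1)] inv(2) assms])
qed

section \<open>Difference quotients of modulations\<close>

lemma norm_unit_phase_diff_le: "cmod (unit_phase t - 1) \<le> 2 * pi * \<bar>t\<bar>"
proof -
  have "cmod (exp (\<i> * complex_of_real (2 * pi * t)) - 1) \<le> \<bar>2 * pi * t\<bar>"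
    using iexp_approx1[of "2 * pi * t" 0] by simp
  moreover have "unit_phase t = exp (\<i> * complex_of_real (2 * pi * t))"
    by (simp add: unit_phase_def mult_ac)
  ultimately show ?thesis
    by (simp add: abs_mult)
qed

lemma unit_phase_difference_quotient:
  assumes "s \<longlonglongrightarrow> 0" "\<And>k. s k \<noteq> (0::real)"
  shows "(\<lambda>k. (unit_phase (s k * y) - 1) / complex_of_real (s k)) \<longlonglongrightarrow> 2 * pi * \<i> * complex_of_real y"
proof -
  have "((\<lambda>z. exp (2 * pi * \<i> * complex_of_real y * z)) has_field_derivative 2 * pi * \<i> * complex_of_real y) (at 0)"
    by (auto intro!: derivative_eq_intros)
  then have "((\<lambda>z. (exp (2 * pi * \<i> * complex_of_real y * z) - 1) / z) \<longlongrightarrow> 2 * pi * \<i> * complex_of_real y) (at 0)"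
    by (simp add: has_field_derivative_iff)
  moreover have "filterlim (\<lambda>k. complex_of_real (s k)) (at 0) sequentially"
    unfolding filterlim_at using assms tendsto_of_real[OF assms(1), where 'a = complex] by auto
  ultimately have "(\<lambda>k. (exp (2 * pi * \<i> * complex_of_real y * complex_of_real (s k)) - 1) / complex_of_real (s k))
      \<longlonglongrightarrow> 2 * pi * \<i> * complex_of_real y"
    by (rule filterlim_compose)
  then show ?thesis
    by (simp add: unit_phase_def mult_ac)
qed

text \<open>The elementary bound on \<open>unit_phase t - 1\<close> dominates all quotients at once
  by 2 pi times \<open>\<bar>b \<bullet> x\<bar> * cmod (f x)\<close>, which is square integrable by
  \<open>bf\<close>; the limit obeys the same bound, whence the constant 4 pi.\<close>

lemma L2_tendsto_modulation_quotient:
  fixes f :: "'a::euclidean_space \<Rightarrow> complex"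
  assumes f: "f \<in> L2" and bf: "(\<lambda>x. complex_of_real (b \<bullet> x) * f x) \<in> L2"
    and s: "s \<longlonglongrightarrow> 0" "\<And>k. s k \<noteq> (0::real)"
  shows "L2_tendsto (\<lambda>k x. (unit_phase (s k * (b \<bullet> x)) - 1) / complex_of_real (s k) * f x)
    (\<lambda>x. 2 * pi * \<i> * (complex_of_real (b \<bullet> x) * f x))"
proof -
  have [measurable]: "f \<in> borel_measurable borel"
    using f by (rule L2_measurable)
  let ?q = "\<lambda>k x. (unit_phase (s k * (b \<bullet> x)) - 1) / complex_of_real (s k)"
  let ?l = "\<lambda>x. 2 * pi * \<i> * (complex_of_real (b \<bullet> x) * f x)"
  have bound: "cmod (?q k x * f x) \<le> 2 * pi * cmod (complex_of_real (b \<bullet> x) * f x)" for k x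
  proof -
    have "cmod (?q k x) \<le> 2 * pi * \<bar>b \<bullet> x\<bar>"
      using norm_unit_phase_diff_le[of "s k * (b \<bullet> x)"] s(2)[of k]
      by (simp add: norm_divide abs_mult field_simps)
    then have "cmod (?q k x) * cmod (f x) \<le> 2 * pi * \<bar>b \<bullet> x\<bar> * cmod (f x)"
      by (rule mult_right_mono) simp
    then show ?thesis by (simp only: norm_mult norm_of_real mult.assoc)
  qed
  have q_L2: "(\<lambda>x. ?q k x * f x) \<in> L2" for k
    using bound by (intro L2_dominated[OF bf, where C = "2 * pi"]) auto
  have l_L2: "?l \<in> L2"
    using bf by (rule L2_scale)
  have "(\<lambda>k. LINT x|lborel. (cmod (?q k x * f x - ?l x))\<^sup>2) \<longlonglongrightarrow> (LINT x|(lborel :: 'a measure). 0)"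
  proof (rule integral_dominated_convergence[where w = "\<lambda>x::'a. (4 * pi)\<^sup>2 * (cmod (complex_of_real (b \<bullet> x) * f x))\<^sup>2"])
    show "integrable lborel (\<lambda>x. (4 * pi)\<^sup>2 * (cmod (complex_of_real (b \<bullet> x) * f x))\<^sup>2)"
      using L2_square_integrable[OF bf] by (intro integrable_mult_right)
    show "AE x in lborel. (\<lambda>k. (cmod (?q k x * f x - ?l x))\<^sup>2) \<longlonglongrightarrow> 0"
    proof (rule AE_I2)
      fix x
      have "(\<lambda>k. (cmod (?q k x * f x - ?l x))\<^sup>2) \<longlonglongrightarrow> (cmod (2 * pi * \<i> * complex_of_real (b \<bullet> x) * f x - ?l x))\<^sup>2"
        by (intro tendsto_intros unit_phase_difference_quotient s)
      then show "(\<lambda>k. (cmod (?q k x * f x - ?l x))\<^sup>2) \<longlonglongrightarrow> 0"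
        by (simp add: mult.assoc)
    qed
    show "AE x in lborel. norm ((cmod (?q k x * f x - ?l x))\<^sup>2) \<le> (4 * pi)\<^sup>2 * (cmod (complex_of_real (b \<bullet> x) * f x))\<^sup>2" for k
    proof (rule AE_I2)
      fix x
      have "cmod (?q k x * f x - ?l x) \<le> 4 * pi * cmod (complex_of_real (b \<bullet> x) * f x)"
        using norm_triangle_ineq4[of "?q k x * f x" "?l x"] bound[of k x] by (simp add: norm_mult)
      then have "(cmod (?q k x * f x - ?l x))\<^sup>2 \<le> (4 * pi * cmod (complex_of_real (b \<bullet> x) * f x))\<^sup>2"
        by (rule power_mono) simp
      then show "norm ((cmod (?q k x * f x - ?l x))\<^sup>2) \<le> (4 * pi)\<^sup>2 * (cmod (complex_of_real (b \<bullet> x) * f x))\<^sup>2"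
        by (simp only: power_mult_distrib norm_power) simp
    qed
  qed measurable
  then have "(\<lambda>k. sqrt (LINT x|lborel. (cmod (?q k x * f x - ?l x))\<^sup>2)) \<longlonglongrightarrow> sqrt 0"
    by (intro tendsto_real_sqrt) simp
  then show ?thesis
    using q_L2 l_L2 by (simp add: L2_tendsto_def L2_norm_def)
qed

section \<open>The uncertainty principle\<close>

text \<open>Transfers convergence back from the frequency side, where translations act as
  modulations and the previous estimate applies.\<close>

lemma is_fourier_L2_tendsto:
  assumes uv: "\<And>k. is_fourier_L2 (u k) (v k)" and fh: "is_fourier_L2 f h" and lim: "L2_tendsto v h"
  shows "L2_tendsto u f"
proof -
  have "L2_norm (\<lambda>x. v k x - h x) = L2_norm (\<lambda>x. u k x - f x)" for k
    by (rule is_fourier_L2_norm[OF is_fourier_L2_diff[OF uv fh]])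
  then show ?thesis
    using lim is_fourier_L2_in_L2[OF uv] is_fourier_L2_in_L2[OF fh] by (simp add: L2_tendsto_def)
qed

text \<open>Multiplying a convergent difference quotient by its vanishing step gives continuity of
  the one-parameter group at \<open>f\<close>.\<close>

lemma L2_tendsto_of_bounded_quotient:
  assumes quotient: "L2_tendsto (\<lambda>k x. (1 / complex_of_real (s k)) * (u k x - f x)) l"
    and s: "s \<longlonglongrightarrow> 0" "\<And>k. s k \<noteq> 0" and L2: "\<And>k. u k \<in> L2" "f \<in> L2"
  shows "L2_tendsto u f"
proof -
  have "(\<lambda>k. cmod (complex_of_real (s k)) * L2_norm (\<lambda>x. (1 / complex_of_real (s k)) * (u k x - f x))) \<longlonglongrightarrow> cmod (complex_of_real 0) * L2_norm l"
    by (intro tendsto_intros s L2_tendsto_norm quotient)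
  moreover have "cmod (complex_of_real (s k)) * L2_norm (\<lambda>x. (1 / complex_of_real (s k)) * (u k x - f x)) = L2_norm (\<lambda>x. u k x - f x)" for k
    using s(2)[of k] by (simp only: L2_norm_scale norm_divide norm_of_real norm_one) simp
  ultimately show ?thesis
    using L2 by (simp add: L2_tendsto_def)
qed

text \<open>Instead of differentiating, one compares the difference quotients along the one-parameter
  groups of modulations and translations, which commute up to an explicit phase.\<close>

lemma canonical_commutation:
  fixes f :: "'a::euclidean_space \<Rightarrow> complex"
  assumes fh: "is_fourier_L2 f h"
    and p: "(\<lambda>x. complex_of_real (b \<bullet> x) * f x) \<in> L2"
    and q: "is_fourier_L2 q (\<lambda>\<xi>. complex_of_real (b \<bullet> \<xi>) * h \<xi>)"
    and b: "b \<bullet> b = 1"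
  shows "Im (L2_inner q (\<lambda>x. complex_of_real (b \<bullet> x) * f x)) = - (L2_norm f)\<^sup>2 / (4 * pi)"
proof -
  let ?p = "\<lambda>x. complex_of_real (b \<bullet> x) * f x"
  note L2 = is_fourier_L2_in_L2[OF fh] is_fourier_L2_in_L2[OF q]
  define E where "E t = tf_shift 0 (t *\<^sub>R b) f" for t
  define V where "V t = tf_shift (t *\<^sub>R b) 0 f" for t
  define A where "A t = (\<lambda>x. (1 / complex_of_real t) * (E t x - f x))" for t
  define B where "B t = (\<lambda>x. (1 / complex_of_real t) * (V t x - f x))" for t
  have EV_L2 [intro, simp]: "E t \<in> L2" "V t \<in> L2" "A t \<in> L2" "B t \<in> L2" for t
    unfolding A_def B_def E_def V_def by (intro L2_scale L2_diff tf_shift_L2 L2)+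
  have A_lim: "L2_tendsto (\<lambda>k. A (s k)) (\<lambda>x. 2 * pi * \<i> * ?p x)"
    if s: "s \<longlonglongrightarrow> 0" "\<And>k. s k \<noteq> 0" for s
  proof -
    have "A (s k) = (\<lambda>x. (unit_phase (s k * (b \<bullet> x)) - 1) / complex_of_real (s k) * f x)" for k
      by (auto simp: A_def E_def tf_shift_def algebra_simps diff_divide_distrib)
    then show ?thesis
      using L2_tendsto_modulation_quotient[OF L2(1) p s] by simp
  qed
  have B_lim: "L2_tendsto (\<lambda>k. B (s k)) (\<lambda>x. - (2 * pi * \<i>) * q x)"
    if s: "s \<longlonglongrightarrow> 0" "\<And>k. s k \<noteq> 0" for s
  proof (rule is_fourier_L2_tendsto)
    let ?v = "\<lambda>k \<xi>. (1 / complex_of_real (s k)) * (unit_phase (- (s k * (b \<bullet> \<xi>))) * h \<xi> - h \<xi>)"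
    show "is_fourier_L2 (B (s k)) (?v k)" for k
    proof -
      have "is_fourier_L2 (V (s k)) (\<lambda>\<xi>. unit_phase (- (s k * (b \<bullet> \<xi>))) * h \<xi>)"
        using is_fourier_L2_tf_shift[OF fh, of "s k *\<^sub>R b" 0] by (simp add: V_def tf_shift_def)
      then show ?thesis
        unfolding B_def by (intro is_fourier_L2_scale is_fourier_L2_diff fh)
    qed
    show "is_fourier_L2 (\<lambda>x. - (2 * pi * \<i>) * q x) (\<lambda>\<xi>. - (2 * pi * \<i>) * (complex_of_real (b \<bullet> \<xi>) * h \<xi>))"
      by (rule is_fourier_L2_scale[OF q])
    \<comment> \<open>Translation by \<open>s k\<close> is modulation by \<open>- s k\<close> on the
      frequency side; the modulation quotient is taken along the steps \<open>- s k\<close>, and the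
      sign in front restores the denominator \<open>s k\<close>.\<close>
    have "L2_tendsto (\<lambda>k \<xi>. (-1) * ((unit_phase (- s k * (b \<bullet> \<xi>)) - 1) / complex_of_real (- s k) * h \<xi>))
      (\<lambda>\<xi>. (-1) * (2 * pi * \<i> * (complex_of_real (b \<bullet> \<xi>) * h \<xi>)))"
      using tendsto_minus[OF s(1)] s(2)
      by (intro L2_tendsto_scale L2_tendsto_modulation_quotient L2) auto
    moreover have "(\<lambda>k \<xi>. (-1) * ((unit_phase (- s k * (b \<bullet> \<xi>)) - 1) / complex_of_real (- s k) * h \<xi>)) = ?v"
      using s(2) by (intro ext) (simp add: field_simps)
    ultimately have "L2_tendsto ?v (\<lambda>\<xi>. (-1) * (2 * pi * \<i> * (complex_of_real (b \<bullet> \<xi>) * h \<xi>)))"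
      by (simp only:)
    then show "L2_tendsto ?v (\<lambda>\<xi>. - (2 * pi * \<i>) * (complex_of_real (b \<bullet> \<xi>) * h \<xi>))"
      by simp
  qed
  \<comment> \<open>By unitarity the mixed terms with \<open>f\<close> agree on both sides and
    cancel; what survives is the failure of \<open>E\<close> and \<open>V\<close> to commute, a
    phase of parameter \<open>t\<^sup>2\<close>. The factor \<open>* 1\<close> puts it in the shape
    of \<open>unit_phase_difference_quotient\<close> with step \<open>t\<^sup>2\<close>.\<close>
  have quotient_commutator: "L2_inner (A t) (B t) - L2_inner (B (- t)) (A (- t))
      = - ((unit_phase (t\<^sup>2 * 1) - 1) / complex_of_real (t\<^sup>2)) * L2_inner (E t) (V t)" if "t \<noteq> 0" for t
  proof -
    let ?c = "1 / complex_of_real t"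
    have expand: "L2_inner (\<lambda>x. u x - f x) (\<lambda>x. v x - f x) = L2_inner u v - L2_inner u f - L2_inner f v + L2_inner f f"
      if "u \<in> L2" "v \<in> L2" for u v
      using that L2 by (simp add: L2_inner_diff_left L2_inner_diff_right L2_diff)
    have AB: "L2_inner (A t) (B t) = ?c * (?c * (L2_inner (E t) (V t) - L2_inner (E t) f - L2_inner f (V t) + L2_inner f f))"
      unfolding A_def B_def L2_inner_scale_left L2_inner_scale_right expand[OF EV_L2(1,2)] by simp
    have BA: "L2_inner (B (- t)) (A (- t))
        = ?c * (?c * (L2_inner (V (- t)) (E (- t)) - L2_inner (V (- t)) f - L2_inner f (E (- t)) + L2_inner f f))"
      unfolding A_def B_def L2_inner_scale_left L2_inner_scale_right expand[OF EV_L2(2,1)] by simp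
    have E: "L2_inner f (E (- t)) = L2_inner (E t) f"
      using L2_inner_tf_shift[of f "E (- t)" 0 "t *\<^sub>R b"] L2 by (simp add: E_def tf_shift_tf_shift tf_shift_L2)
    have V: "L2_inner (V (- t)) f = L2_inner f (V t)"
      using L2_inner_tf_shift[of "V (- t)" f "t *\<^sub>R b" 0] L2 by (simp add: V_def tf_shift_tf_shift tf_shift_L2)
    have VE: "L2_inner (V (- t)) (E (- t)) = unit_phase (t\<^sup>2) * L2_inner (E t) (V t)"
    proof -
      have "tf_shift (t *\<^sub>R b) (t *\<^sub>R b) (V (- t)) = E t"
        by (simp add: V_def E_def tf_shift_tf_shift)
      moreover have "tf_shift (t *\<^sub>R b) (t *\<^sub>R b) (E (- t)) = (\<lambda>x. unit_phase (- t\<^sup>2) * V t x)"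
        by (simp add: V_def E_def tf_shift_tf_shift b power2_eq_square)
      moreover have "L2_inner (tf_shift (t *\<^sub>R b) (t *\<^sub>R b) (V (- t))) (tf_shift (t *\<^sub>R b) (t *\<^sub>R b) (E (- t)))
          = L2_inner (V (- t)) (E (- t))"
        by (rule L2_inner_tf_shift) auto
      ultimately show ?thesis
        by (simp add: L2_inner_scale_right cnj_unit_phase)
    qed
    show ?thesis
      unfolding AB BA E V VE by (simp add: power2_eq_square diff_divide_distrib algebra_simps)
  qed
  define t where "t k = 1 / real (Suc k)" for k
  have t: "t \<longlonglongrightarrow> 0" "\<And>k. t k \<noteq> 0"
    unfolding t_def using LIMSEQ_Suc[OF lim_1_over_n] by auto
  have mt: "(\<lambda>k. - t k) \<longlonglongrightarrow> 0" "\<And>k. - t k \<noteq> 0"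
    using tendsto_minus[OF t(1)] t(2) by auto
  have t2: "(\<lambda>k. (t k)\<^sup>2) \<longlonglongrightarrow> 0" "\<And>k. (t k)\<^sup>2 \<noteq> 0"
    using tendsto_power[OF t(1), of 2] t(2) by auto
  have E_lim: "L2_tendsto (\<lambda>k. E (t k)) f"
    by (rule L2_tendsto_of_bounded_quotient[OF A_lim[OF t, unfolded A_def] t]) (auto intro: L2)
  have V_lim: "L2_tendsto (\<lambda>k. V (t k)) f"
    by (rule L2_tendsto_of_bounded_quotient[OF B_lim[OF t, unfolded B_def] t]) (auto intro: L2)
  have "(\<lambda>k. L2_inner (A (t k)) (B (t k)) - L2_inner (B (- t k)) (A (- t k)))
      \<longlonglongrightarrow> L2_inner (\<lambda>x. 2 * pi * \<i> * ?p x) (\<lambda>x. - (2 * pi * \<i>) * q x)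
        - L2_inner (\<lambda>x. - (2 * pi * \<i>) * q x) (\<lambda>x. 2 * pi * \<i> * ?p x)"
    by (intro tendsto_diff L2_tendsto_inner A_lim B_lim t mt)
  moreover have "(\<lambda>k. L2_inner (A (t k)) (B (t k)) - L2_inner (B (- t k)) (A (- t k)))
      \<longlonglongrightarrow> - (2 * pi * \<i> * complex_of_real 1) * L2_inner f f"
    unfolding quotient_commutator[OF t(2)]
    by (intro tendsto_mult tendsto_minus L2_tendsto_inner E_lim V_lim unit_phase_difference_quotient t2)
  ultimately have "L2_inner (\<lambda>x. 2 * pi * \<i> * ?p x) (\<lambda>x. - (2 * pi * \<i>) * q x)
        - L2_inner (\<lambda>x. - (2 * pi * \<i>) * q x) (\<lambda>x. 2 * pi * \<i> * ?p x) = - (2 * pi * \<i> * complex_of_real 1) * L2_inner f f"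
    by (rule LIMSEQ_unique)
  \<comment> \<open>The limit of the left side is 4 pi^2 times twice the imaginary part times i,
    that of the right side is -2 pi i times the squared norm; dividing gives the constant -1/(4
    pi).\<close>
  then have "4 * (complex_of_real pi)\<^sup>2 * (L2_inner q ?p - cnj (L2_inner q ?p)) = - (2 * pi * \<i>) * complex_of_real ((L2_norm f)\<^sup>2)"
    unfolding L2_inner_scale_left L2_inner_scale_right L2_inner_self L2_inner_cnj
    by (simp add: algebra_simps power2_eq_square)
  then have "Im (4 * (complex_of_real pi)\<^sup>2 * (L2_inner q ?p - cnj (L2_inner q ?p))) = Im (- (2 * pi * \<i>) * complex_of_real ((L2_norm f)\<^sup>2))"
    by (rule arg_cong)
  then have "4 * pi\<^sup>2 * (2 * Im (L2_inner q ?p)) = - (2 * pi) * (L2_norm f)\<^sup>2"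
    by (simp add: power2_eq_square)
  then have "2 * pi * (4 * pi * Im (L2_inner q ?p)) = 2 * pi * (- (L2_norm f)\<^sup>2)"
    by (simp add: power2_eq_square)
  then have "4 * pi * Im (L2_inner q ?p) = - (L2_norm f)\<^sup>2"
    unfolding mult_cancel_left by simp
  then show ?thesis
    by (subst nonzero_eq_divide_eq) (simp_all add: mult.commute)
qed

text \<open>Completeness is given as density of finite combinations, not as a series. Over any
  finite set containing the indices of a good combination, the orthogonal projection approximates
  \<open>f\<close> at least as well; Cauchy-Schwarz carries this to the pairing with
  \<open>h\<close>. The summation is unordered, which later permits reindexing by negation.\<close>

lemma L2_orthonormal_basis_has_sum:
  assumes basis: "L2_orthonormal_basis I e" and f: "f \<in> L2" and h: "h \<in> L2"
  shows "((\<lambda>i. L2_inner f (e i) * L2_inner (e i) h) has_sum L2_inner f h) I"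
  unfolding has_sum_def tendsto_iff eventually_finite_subsets_at_top
proof (intro allI impI)
  fix \<epsilon> :: real assume "\<epsilon> > 0"
  have e: "e i \<in> L2" if "i \<in> I" for i
    using basis that by (auto simp: L2_orthonormal_basis_def)
  have orth: "L2_inner (e i) (e j) = (if i = j then 1 else 0)" if "i \<in> I" "j \<in> I" for i j
    using basis that by (auto simp: L2_orthonormal_basis_def)
  \<comment> \<open>Adding 1 keeps the denominator positive when \<open>h\<close> is null.\<close>
  let ?\<delta> = "\<epsilon> / (L2_norm h + 1)"
  have pos: "L2_norm h + 1 > 0" using L2_norm_nonneg[of h] by linarith
  obtain J c where J: "finite J" "J \<subseteq> I" "L2_norm (\<lambda>x. f x - (\<Sum>i\<in>J. c i * e i x)) < ?\<delta>"
    using basis f \<open>\<epsilon> > 0\<close> pos unfolding L2_orthonormal_basis_def by (meson divide_pos_pos)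
  have "dist (\<Sum>i\<in>Y. L2_inner f (e i) * L2_inner (e i) h) (L2_inner f h) < \<epsilon>"
    if Y: "finite Y" "J \<subseteq> Y" "Y \<subseteq> I" for Y
  proof -
    define S where "S = (\<lambda>a x. \<Sum>i\<in>Y. a i * e i x)"
    have S_L2: "S a \<in> L2" for a
      unfolding S_def using Y by (intro L2_sum L2_scale e) auto
    have S_inner: "L2_inner (S a) g = (\<Sum>i\<in>Y. a i * L2_inner (e i) g)" if "g \<in> L2" for a g
      unfolding S_def using Y that
      by (subst L2_inner_sum_left) (auto intro: e L2_scale simp: L2_inner_scale_left)
    define a where "a i = L2_inner f (e i)" for i
    \<comment> \<open>The given approximation error is \<open>r + S d\<close> with \<open>r\<close>
      orthogonal to \<open>S d\<close>, so by Pythagoras it is no smaller than the projection error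
      \<open>r\<close>.\<close>
    define d where "d i = a i - (if i \<in> J then c i else 0)" for i
    define r where "r = (\<lambda>x. f x - S a x)"
    have r: "r \<in> L2" unfolding r_def by (intro L2_diff f S_L2)
    have r_orth: "L2_inner r (e j) = 0" if "j \<in> Y" for j
    proof -
      have j: "j \<in> I" using that Y by auto
      have "L2_inner (S a) (e j) = (\<Sum>i\<in>Y. if i = j then a i else 0)"
        unfolding S_inner[OF e[OF j]] using Y j by (intro sum.cong) (auto simp: orth)
      also have "\<dots> = a j" using that Y by simp
      finally show ?thesis
        unfolding r_def a_def[of j] using f S_L2 e[OF j] by (simp add: L2_inner_diff_left a_def)
    qed
    have "(\<lambda>x. f x - (\<Sum>i\<in>J. c i * e i x)) = (\<lambda>x. r x + S d x)"
    proof
      fix x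
      have "(\<Sum>i\<in>J. c i * e i x) = (\<Sum>i\<in>Y. (if i \<in> J then c i else 0) * e i x)"
        using Y by (intro sum.mono_neutral_cong_left) auto
      then show "f x - (\<Sum>i\<in>J. c i * e i x) = r x + S d x"
        by (simp add: r_def S_def d_def left_diff_distrib sum_subtractf)
    qed
    moreover have "L2_inner r (S d) = 0"
    proof -
      have "L2_inner (e i) r = 0" if "i \<in> Y" for i
        using r_orth[OF that] L2_inner_cnj[of r "e i"] by simp
      then have "L2_inner (S d) r = 0" unfolding S_inner[OF r] by simp
      then show ?thesis using L2_inner_cnj[of "S d" r] by simp
    qed
    ultimately have "(L2_norm r)\<^sup>2 \<le> (L2_norm (\<lambda>x. f x - (\<Sum>i\<in>J. c i * e i x)))\<^sup>2"
      by (simp add: L2_norm_add_square[OF r S_L2])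
    then have "L2_norm r \<le> L2_norm (\<lambda>x. f x - (\<Sum>i\<in>J. c i * e i x))"
      by (rule power2_le_imp_le) simp
    with J have "L2_norm r < ?\<delta>" by linarith
    have "dist (\<Sum>i\<in>Y. L2_inner f (e i) * L2_inner (e i) h) (L2_inner f h) = cmod (L2_inner r h)"
      unfolding r_def using f h S_L2
      by (simp add: L2_inner_diff_left S_inner a_def dist_norm norm_minus_commute)
    also have "\<dots> \<le> L2_norm r * L2_norm h"
      by (rule L2_Cauchy_Schwarz[OF r h])
    also have "\<dots> \<le> L2_norm r * (L2_norm h + 1)"
      by (intro mult_left_mono) auto
    also have "\<dots> < \<epsilon>"
      using \<open>L2_norm r < ?\<delta>\<close> pos by (simp add: field_simps)
    finally show ?thesis .
  qed
  with J show "\<exists>X. finite X \<and> X \<subseteq> I \<and> (\<forall>Y. finite Y \<and> X \<subseteq> Y \<and> Y \<subseteq> I \<longrightarrow>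
      dist (\<Sum>i\<in>Y. L2_inner f (e i) * L2_inner (e i) h) (L2_inner f h) < \<epsilon>)"
    by blast
qed

lemma L2_orthonormal_basis_nonempty:
  assumes "L2_orthonormal_basis I (e :: 'i \<Rightarrow> 'a::euclidean_space \<Rightarrow> complex)"
  shows "I \<noteq> {}"
proof
  assume "I = {}"
  let ?g = "\<lambda>x::'a. complex_of_real (gauss 1 x)"
  have g: "?g \<in> L2" by (rule gauss_L2) simp
  have "((\<lambda>i. L2_inner ?g (e i) * L2_inner (e i) ?g) has_sum L2_inner ?g ?g) I"
    by (rule L2_orthonormal_basis_has_sum[OF assms g g])
  then have "((\<lambda>i. L2_inner ?g (e i) * L2_inner (e i) ?g) has_sum L2_inner ?g ?g) {}"
    using \<open>I = {}\<close> by simp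
  then have "L2_inner ?g ?g = 0"
    by (rule has_sum_unique) (rule has_sum_empty)
  then have "L2_norm ?g = 0"
    unfolding L2_inner_self of_real_eq_0_iff by simp
  then have "AE x::'a in lborel. False"
    using L2_norm_eq_0_iff[OF g] by (simp add: gauss_def)
  then show False
    by (simp add: ae_filter_eq_bot_iff eventually_False)
qed

text \<open>For distinct \<open>\<lambda>\<close>, \<open>\<mu>\<close> the time-frequency shift by \<open>- \<lambda> - \<mu>\<close> exchanges the pair
  \<open>(\<mu>, \<lambda>)\<close> with \<open>(- \<lambda>, - \<mu>)\<close>, and self-adjointness exchanges \<open>(- \<lambda>, - \<mu>)\<close> with \<open>(- \<mu>, - \<lambda>)\<close>
  up to conjugation.\<close>

lemma no_localized_gabor_basis:
  fixes g :: "'a::euclidean_space \<Rightarrow> complex" and \<Lambda> :: "('a \<times> 'a) set"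
  assumes symmetric: "\<Lambda> = uminus ` \<Lambda>"
    and basis: "L2_orthonormal_basis \<Lambda> (\<lambda>(m, n). tf_shift m n g)"
    and gh: "is_fourier_L2 g h"
    and p: "(\<lambda>x. complex_of_real (b \<bullet> x) * g x) \<in> L2"
    and bh: "(\<lambda>\<xi>. complex_of_real (b \<bullet> \<xi>) * h \<xi>) \<in> L2"
    and b: "b \<bullet> b = 1"
  shows False
proof -
  define T where "T l = tf_shift (fst l) (snd l)" for l :: "'a \<times> 'a"
  obtain q where q: "is_fourier_L2 q (\<lambda>\<xi>. complex_of_real (b \<bullet> \<xi>) * h \<xi>)"
    using is_fourier_L2_surj[OF bh] by blast
  let ?p = "\<lambda>x. complex_of_real (b \<bullet> x) * g x"
  note L2 = is_fourier_L2_in_L2[OF gh] is_fourier_L2_in_L2[OF q] p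
  have T_L2 [intro, simp]: "T l f \<in> L2" if "f \<in> L2" for l f
    unfolding T_def using that by (rule tf_shift_L2)
  have T_add: "T s (T l f) = (\<lambda>x. unit_phase (snd l \<bullet> fst s) * T (s + l) f x)" for s l f
    by (simp add: T_def tf_shift_tf_shift)
  have T_basis: "L2_orthonormal_basis \<Lambda> (\<lambda>l. T l g)"
    using basis by (simp add: T_def case_prod_unfold)
  have T_orth: "L2_inner (T l g) (T l' g) = (if l = l' then 1 else 0)" if "l \<in> \<Lambda>" "l' \<in> \<Lambda>" for l l'
    using T_basis that by (auto simp: L2_orthonormal_basis_def)
  have neg: "- l \<in> \<Lambda>" if "l \<in> \<Lambda>" for l
    using symmetric that by (metis imageI)
  \<comment> \<open>Position and momentum applied to the shifted \<open>g\<close>, written as the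
    shift of \<open>p\<close> or \<open>q\<close> minus a real multiple of the basis element itself;
    \<open>P_eq\<close> and \<open>Q_fourier\<close> identify them with the operators.\<close>
  define P where "P l = (\<lambda>x. T l ?p x - complex_of_real (b \<bullet> fst l) * T l g x)" for l
  define Q where "Q l = (\<lambda>x. T l q x - complex_of_real (b \<bullet> snd l) * T l g x)" for l
  define H where "H l = (\<lambda>\<xi>. unit_phase (- (fst l \<bullet> snd l)) * tf_shift (snd l) (- fst l) h \<xi>)" for l
  have PQ_L2 [intro, simp]: "P l \<in> L2" "Q l \<in> L2" for l
    unfolding P_def Q_def by (intro L2_diff L2_scale T_L2 L2)+
  have P_eq: "P l = (\<lambda>x. complex_of_real (b \<bullet> x) * T l g x)" for l
    by (rule ext) (simp add: P_def T_def tf_shift_def inner_add_right algebra_simps)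
  have T_fourier: "is_fourier_L2 (T l g) (H l)" for l
    unfolding T_def H_def by (rule is_fourier_L2_tf_shift[OF gh])
  have Q_fourier: "is_fourier_L2 (Q l) (\<lambda>\<xi>. complex_of_real (b \<bullet> \<xi>) * H l \<xi>)" for l
  proof -
    let ?bh = "\<lambda>\<xi>. complex_of_real (b \<bullet> \<xi>) * h \<xi>"
    have "is_fourier_L2 (Q l) (\<lambda>\<xi>. unit_phase (- (fst l \<bullet> snd l)) * tf_shift (snd l) (- fst l) ?bh \<xi>
        - complex_of_real (b \<bullet> snd l) * H l \<xi>)"
      unfolding Q_def T_def[of l, symmetric]
      by (intro is_fourier_L2_diff is_fourier_L2_scale T_fourier)
        (unfold T_def, rule is_fourier_L2_tf_shift[OF q])
    also have "(\<lambda>\<xi>. unit_phase (- (fst l \<bullet> snd l)) * tf_shift (snd l) (- fst l) ?bh \<xi>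
        - complex_of_real (b \<bullet> snd l) * H l \<xi>) = (\<lambda>\<xi>. complex_of_real (b \<bullet> \<xi>) * H l \<xi>)"
      by (rule ext) (simp add: H_def tf_shift_def inner_add_right algebra_simps)
    finally show ?thesis .
  qed
  have P_selfadjoint: "L2_inner (P l) (T l' g) = L2_inner (T l g) (P l')" for l l'
    unfolding P_eq L2_inner_def by (simp add: mult_ac)
  have Q_selfadjoint: "L2_inner (Q l) (T l' g) = L2_inner (T l g) (Q l')" for l l'
  proof -
    have "L2_inner (Q l) (T l' g) = L2_inner (\<lambda>\<xi>. complex_of_real (b \<bullet> \<xi>) * H l \<xi>) (H l')"
      by (rule is_fourier_L2_inner[OF Q_fourier T_fourier, symmetric])
    also have "\<dots> = L2_inner (H l) (\<lambda>\<xi>. complex_of_real (b \<bullet> \<xi>) * H l' \<xi>)"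
      unfolding L2_inner_def by (simp add: mult_ac)
    also have "\<dots> = L2_inner (T l g) (Q l')"
      by (rule is_fourier_L2_inner[OF T_fourier Q_fourier])
    finally show ?thesis .
  qed
  \<comment> \<open>\<open>\<Phi> u l\<close> is the term at \<open>l\<close> of the expansion of
    the pairing of \<open>Q u\<close> with \<open>P u\<close>. \<open>\<Psi>\<close> drops the
    corrections: this makes it invariant under common shifts, which \<open>\<Phi>\<close> on the
    diagonal is not.\<close>
  define \<Phi> where "\<Phi> u l = L2_inner (Q u) (T l g) * L2_inner (T l g) (P u)" for u l
  define \<Psi> where "\<Psi> u l = L2_inner (T u q) (T l g) * L2_inner (T l g) (T u ?p)" for u l
  have \<Phi>_cnj: "\<Phi> l u = cnj (\<Phi> u l)" for l u
    unfolding \<Phi>_def complex_cnj_mult L2_inner_cnj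
    using P_selfadjoint Q_selfadjoint by simp
  have \<Phi>_eq_\<Psi>: "\<Phi> u l = \<Psi> u l" if "u \<in> \<Lambda>" "l \<in> \<Lambda>" "u \<noteq> l" for u l
    unfolding \<Phi>_def \<Psi>_def P_def Q_def using that L2
    by (simp add: L2_inner_diff_left L2_inner_diff_right L2_inner_scale_left L2_inner_scale_right L2_scale T_orth)
  have \<Psi>_neg: "\<Psi> (- l) (- u) = \<Psi> u l" for u l
  proof -
    \<comment> \<open>Chosen so that \<open>s + u = - l\<close> and \<open>s + l = - u\<close>. The
      phases \<open>\<alpha>\<close> and \<open>\<beta>\<close> each occur once plain and once
      conjugated in the product, so they drop out.\<close>
    define s where "s = - l - u"
    define \<alpha> where "\<alpha> = unit_phase (snd u \<bullet> fst s)"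
    define \<beta> where "\<beta> = unit_phase (snd l \<bullet> fst s)"
    have T_u: "T s (T u f) = (\<lambda>x. \<alpha> * T (- l) f x)" and T_l: "T s (T l f) = (\<lambda>x. \<beta> * T (- u) f x)" for f
      by (simp_all add: T_add s_def \<alpha>_def \<beta>_def)
    have T_inner: "L2_inner (T s f) (T s f') = L2_inner f f'" if "f \<in> L2" "f' \<in> L2" for f f'
      unfolding T_def using that by (rule L2_inner_tf_shift)
    have eq1: "L2_inner (T u q) (T l g) = \<alpha> * cnj \<beta> * L2_inner (T (- l) q) (T (- u) g)"
      using T_inner[OF T_L2[OF L2(3), of u] T_L2[OF L2(1), of l], symmetric]
      unfolding T_u T_l L2_inner_scale_left L2_inner_scale_right by simp
    have eq2: "L2_inner (T l g) (T u ?p) = \<beta> * cnj \<alpha> * L2_inner (T (- u) g) (T (- l) ?p)"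
      using T_inner[OF T_L2[OF L2(1), of l] T_L2[OF p, of u], symmetric]
      unfolding T_u T_l L2_inner_scale_left L2_inner_scale_right by simp
    have "\<alpha> * cnj \<alpha> = 1" "\<beta> * cnj \<beta> = 1"
      by (simp_all add: \<alpha>_def \<beta>_def complex_norm_square[symmetric])
    moreover have "\<Psi> u l = (\<alpha> * cnj \<alpha>) * (\<beta> * cnj \<beta>) * \<Psi> (- l) (- u)"
      unfolding \<Psi>_def eq1 eq2 by (simp only: mult_ac)
    ultimately show ?thesis by simp
  qed
  have Im_\<Phi>_neg: "Im (\<Phi> (- u) (- l)) = - Im (\<Phi> u l)" if "u \<in> \<Lambda>" "l \<in> \<Lambda>" for u l
  proof (cases "u = l")
    case True
    have "Im (\<Phi> v v) = 0" for v
      using arg_cong[OF \<Phi>_cnj[of v v], of Im] by simp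
    then show ?thesis using True by simp
  next
    case False
    then have "\<Phi> u l = \<Phi> (- l) (- u)"
      using \<Phi>_eq_\<Psi>[OF that] \<Phi>_eq_\<Psi>[of "- l" "- u"] neg that \<Psi>_neg[of l u] by simp
    then show ?thesis
      using \<Phi>_cnj[of "- l" "- u"] by simp
  qed
  have expansion: "((\<lambda>l. Im (\<Phi> u l)) has_sum Im (L2_inner (Q u) (P u))) \<Lambda>" for u
    unfolding \<Phi>_def by (intro has_sum_Im L2_orthonormal_basis_has_sum[OF T_basis]) auto
  obtain u where u: "u \<in> \<Lambda>"
    using L2_orthonormal_basis_nonempty[OF T_basis] by blast
  \<comment> \<open>The basis is summed over its negatives, so that the term of the expansion at
    \<open>- u\<close> paired with index \<open>l\<close> of the one at \<open>u\<close> has index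
    \<open>- l\<close>.\<close>
  have "((\<lambda>l. Im (\<Phi> (- u) l)) has_sum Im (L2_inner (Q (- u)) (P (- u)))) (uminus ` \<Lambda>)"
    using expansion[of "- u"] symmetric by simp
  then have "((\<lambda>l. Im (\<Phi> (- u) (- l))) has_sum Im (L2_inner (Q (- u)) (P (- u)))) \<Lambda>"
    by (subst (asm) has_sum_reindex) (auto simp: o_def)
  then have "((\<lambda>l. - Im (\<Phi> u l)) has_sum Im (L2_inner (Q (- u)) (P (- u)))) \<Lambda>"
    by (rule has_sum_cong[THEN iffD1, rotated]) (use Im_\<Phi>_neg u in auto)
  moreover have "((\<lambda>l. - Im (\<Phi> u l)) has_sum - Im (L2_inner (Q u) (P u))) \<Lambda>"
    using expansion by (simp add: has_sum_uminus)
  ultimately have "Im (L2_inner (Q (- u)) (P (- u))) = - Im (L2_inner (Q u) (P u))"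
    by (rule has_sum_unique)
  \<comment> \<open>The constant is the same at \<open>u\<close> and at \<open>- u\<close>, because
    basis elements have norm 1; being its own negative it would be 0.\<close>
  moreover have "Im (L2_inner (Q l) (P l)) = - (L2_norm (T l g))\<^sup>2 / (4 * pi)" for l
    unfolding P_eq by (rule canonical_commutation[OF T_fourier _ Q_fourier b]) (unfold P_eq[symmetric], rule PQ_L2)
  moreover have "(L2_norm (T l g))\<^sup>2 = 1" if "l \<in> \<Lambda>" for l
  proof -
    have "complex_of_real ((L2_norm (T l g))\<^sup>2) = 1"
      unfolding L2_inner_self[symmetric] using T_orth that by simp
    then show ?thesis by (simp only: of_real_eq_1_iff)
  qed
  ultimately show False
    using u neg[OF u] by simp
qed

section \<open>Excluding the product of zero and infinity\<close>

lemma AE_inner_nonzero: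
  fixes b :: "'a::euclidean_space"
  assumes "b \<noteq> 0"
  shows "AE x in lborel. b \<bullet> x \<noteq> 0"
proof -
  have "closed {x. b \<bullet> x = 0}"
    by (intro closed_hyperplane)
  then have "{x. b \<bullet> x = 0} \<in> null_sets lborel"
    using negligible_hyperplane[of b 0] assms
    by (simp add: negligible_iff_null_sets null_sets_completion_iff)
  then show ?thesis
    by (rule AE_I') auto
qed

text \<open>The factor \<open>b \<bullet> x\<close> vanishes only on a hyperplane, a null set, so
  multiplication by it annihilates no function of nonzero norm.\<close>

lemma L2_norm_inner_mult_eq_0:
  fixes b :: "'a::euclidean_space"
  assumes "f \<in> L2" "(\<lambda>x. complex_of_real (b \<bullet> x) * f x) \<in> L2" "b \<noteq> 0"
    and "L2_norm (\<lambda>x. complex_of_real (b \<bullet> x) * f x) = 0"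
  shows "L2_norm f = 0"
proof -
  have "AE x in lborel. complex_of_real (b \<bullet> x) * f x = 0"
    using assms L2_norm_eq_0_iff by blast
  with AE_inner_nonzero[OF assms(3)] have "AE x in lborel. f x = 0"
    by eventually_elim simp
  then show ?thesis
    using L2_norm_eq_0_iff[OF assms(1)] by simp
qed

lemma L2_ext_norm_eq_0_iff: "L2_ext_norm f = 0 \<longleftrightarrow> f \<in> L2 \<and> L2_norm f = 0"
  by (auto simp: L2_ext_norm_def ennreal_eq_0_iff intro: order_antisym[OF _ L2_norm_nonneg])

theorem theorem2p5:
  fixes \<Lambda> :: "((real ^ 'd) \<times> (real ^ 'd)) set"
    and g :: "real ^ 'd \<Rightarrow> complex"
  assumes "countable \<Lambda>"
    and "\<Lambda> = uminus ` \<Lambda>"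
    and "g \<in> L2"
    and "L2_orthonormal_basis \<Lambda> (\<lambda>(m, n). trans_mod m n g)"
  shows "\<forall>i. position_norm i g * momentum_norm i g = \<infinity>"
proof
  fix i :: 'd
  define b :: "real ^ 'd" where "b = axis i 1"
  define h where "h = fourier_L2 g"
  have b: "b \<bullet> b = 1" "b \<noteq> 0"
    by (simp_all add: b_def inner_axis_axis axis_eq_0_iff)
  have coord: "coord_mult i f = (\<lambda>x. complex_of_real (b \<bullet> x) * f x)" for f
    by (rule ext) (simp add: coord_mult_def b_def inner_axis')
  have basis: "L2_orthonormal_basis \<Lambda> (\<lambda>(m, n). tf_shift m n g)"
  proof -
    have "trans_mod m n g = tf_shift m n g" for m n
      by (rule ext) (simp add: trans_mod_def tf_shift_def unit_phase_def)
    then show ?thesis using assms(4) by simp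
  qed
  have gh: "is_fourier_L2 g h"
    unfolding h_def by (rule fourier_L2[OF assms(3)])
  have g_norm: "L2_norm g \<noteq> 0"
  proof -
    obtain m n where "(m, n) \<in> \<Lambda>"
      using L2_orthonormal_basis_nonempty[OF basis] by auto
    then have "L2_inner (tf_shift m n g) (tf_shift m n g) = 1"
      using basis by (fastforce simp: L2_orthonormal_basis_def)
    then show ?thesis
      by (auto simp: L2_inner_self L2_norm_tf_shift[OF assms(3)])
  qed
  have incompatible: "\<not> (coord_mult i g \<in> L2 \<and> coord_mult i h \<in> L2)"
    using no_localized_gabor_basis[OF assms(2) basis gh _ _ b(1)] by (auto simp: coord)
  \<comment> \<open>In \<open>ennreal\<close> the product of 0 and infinity is 0, so one infinite
    factor gives the claim only once neither factor can be 0.\<close>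
  have "position_norm i g \<noteq> 0"
  proof
    assume "position_norm i g = 0"
    then have "coord_mult i g \<in> L2" "L2_norm (coord_mult i g) = 0"
      by (simp_all add: position_norm_def L2_ext_norm_eq_0_iff)
    then show False
      using L2_norm_inner_mult_eq_0[of g b] assms(3) b g_norm by (simp add: coord)
  qed
  moreover have "momentum_norm i g \<noteq> 0"
  proof
    assume "momentum_norm i g = 0"
    then have bh: "coord_mult i h \<in> L2" and "L2_norm (momentum i g) = 0"
      by (simp_all add: momentum_norm_def L2_ext_norm_eq_0_iff h_def split: if_splits)
    \<comment> \<open>By unitarity the momentum norm is computed on the frequency side, where it is
      again a coordinate multiplication.\<close>
    moreover have "is_fourier_L2 (momentum i g) (coord_mult i h)"
      unfolding momentum_def h_def[symmetric] by (rule inv_fourier_L2[OF bh])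
    ultimately have "L2_norm (coord_mult i h) = 0"
      by (simp add: is_fourier_L2_norm)
    then have "L2_norm h = 0"
      using L2_norm_inner_mult_eq_0[of h b] is_fourier_L2_in_L2[OF gh] bh b by (simp add: coord)
    then show False
      using is_fourier_L2_norm[OF gh] g_norm by simp
  qed
  moreover have "position_norm i g = \<infinity> \<or> momentum_norm i g = \<infinity>"
    using incompatible by (auto simp: position_norm_def momentum_norm_def L2_ext_norm_def h_def)
  ultimately show "position_norm i g * momentum_norm i g = \<infinity>"
    by (auto simp: ennreal_mult_top ennreal_top_mult)
qed

end
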